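(* For every $n\ge3$ there is a monotone $7$-harmonic function $H\in C^{1,1/2}_{\mathrm{loc}}((-1,1)^n)\cap W^{1,7}((-1,1)^n)$ such that, for every $v\in W^{1,7}((-1,1)^n)$, the two conditions $$v-H\in W^{1,7}_0((-1,1)^n),\qquad \int_{(-1,1)^n}|\nabla v|^7\,dx\le\int_{(-1,1)^n}|\nabla H|^7\,dx$$ imply $v=H$ almost everywhere. The function $H$ is not $C^2$ at any point of $\{(0,0)\}\times(-1,1)^{n-2}$ (i.e. it is not of class $C^2$ in any neighborhood of such a point). Consequently, no such $v$ has a representative that is smooth near every point outside a discrete subset of $(-1,1)^n$.
   Context: A continuous function $f:\Omega\to\mathbb R$ on an open set $\Omega\subset\mathbb R^n$ is monotone (in the sense of Lebesgue) if $\max_{\overline V}f=\max_{\partial V}f$ and $\min_{\overline V}f=\min_{\partial V}f$ for every nonempty open $V$ with $\overline V$ compact and contained in $\Omega$. A continuous $H\in W^{1,7}_{\mathrm{loc}}(\Omega)$ is $7$-harmonic if $\int_\Omega|\nabla H|^{5}\nabla H\cdot\nabla\varphi\,dx=0$ for all $\varphi\in C_c^\infty(\Omega)$. $W^{1,7}_0(\Omega)$ is the closure of $C_c^\infty(\Omega)$ in $W^{1,7}(\Omega)$. A discrete subset is one each of whose points is isolated in its relative topology. *)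

theory Defs
  imports "HOL-Analysis.Analysis"
begin

text \<open>Functions on an open set \<open>\<Omega>\<close> are total functions on the whole space; their values
  outside \<open>\<Omega>\<close> never matter, except for test functions, which are extended by zero.\<close>

subsection \<open>Classical differentiability\<close>

definition grad :: "(real^'n \<Rightarrow> real) \<Rightarrow> real^'n \<Rightarrow> real^'n" where
  "grad f x = (\<chi> i. frechet_derivative f (at x) (axis i 1))"

text \<open>Meant for open \<open>U\<close>. Differentiability at every stage supplies the continuity of all
  partial derivatives of lower order.\<close>

primrec C_k_on :: "nat \<Rightarrow> (real^'n) set \<Rightarrow> (real^'n \<Rightarrow> real) \<Rightarrow> bool" where
  "C_k_on 0 U f \<longleftrightarrow> continuous_on U f"
| "C_k_on (Suc k) U f \<longleftrightarrow>
     (\<forall>x\<in>U. f differentiable (at x)) \<and> (\<forall>i. C_k_on k U (\<lambda>x. grad f x $ i))"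

definition smooth_on :: "(real^'n) set \<Rightarrow> (real^'n \<Rightarrow> real) \<Rightarrow> bool" where
  "smooth_on U f \<longleftrightarrow> (\<forall>k. C_k_on k U f)"

definition C_k_near :: "nat \<Rightarrow> real^'n \<Rightarrow> (real^'n \<Rightarrow> real) \<Rightarrow> bool" where
  "C_k_near k x f \<longleftrightarrow> (\<exists>U. open U \<and> x \<in> U \<and> C_k_on k U f)"

definition smooth_near :: "real^'n \<Rightarrow> (real^'n \<Rightarrow> real) \<Rightarrow> bool" where
  "smooth_near x f \<longleftrightarrow> (\<exists>U. open U \<and> x \<in> U \<and> smooth_on U f)"

text \<open>The local Hoelder class of continuously differentiable functions on \<open>\<Omega>\<close> whose gradient is
  Hoelder continuous with exponent \<open>\<alpha>\<close> on compact subsets.\<close>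

definition C1_hoelder_loc :: "real \<Rightarrow> (real^'n) set \<Rightarrow> (real^'n \<Rightarrow> real) \<Rightarrow> bool" where
  "C1_hoelder_loc \<alpha> \<Omega> f \<longleftrightarrow> C_k_on 1 \<Omega> f \<and>
     (\<forall>K. compact K \<and> K \<subseteq> \<Omega> \<longrightarrow>
        (\<exists>C. \<forall>x\<in>K. \<forall>y\<in>K. norm (grad f x - grad f y) \<le> C * dist x y powr \<alpha>))"

subsection \<open>Monotone functions in the sense of Lebesgue\<close>

text \<open>For continuous \<open>f\<close> the suprema and infima are attained: \<open>closure V\<close> is compact and nonempty,
  and so is \<open>frontier V\<close>, as \<open>V\<close> is open, bounded and nonempty.\<close>

definition lebesgue_monotone :: "(real^'n) set \<Rightarrow> (real^'n \<Rightarrow> real) \<Rightarrow> bool" where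
  "lebesgue_monotone \<Omega> f \<longleftrightarrow> continuous_on \<Omega> f \<and>
     (\<forall>V. open V \<and> V \<noteq> {} \<and> compact (closure V) \<and> closure V \<subseteq> \<Omega> \<longrightarrow>
        (SUP x\<in>closure V. f x) = (SUP x\<in>frontier V. f x) \<and>
        (INF x\<in>closure V. f x) = (INF x\<in>frontier V. f x))"

subsection \<open>Sobolev spaces\<close>

definition test_function :: "(real^'n) set \<Rightarrow> (real^'n \<Rightarrow> real) \<Rightarrow> bool" where
  "test_function \<Omega> \<phi> \<longleftrightarrow> smooth_on UNIV \<phi> \<and>
     compact (closure {x. \<phi> x \<noteq> 0}) \<and> closure {x. \<phi> x \<noteq> 0} \<subseteq> \<Omega>"

definition Lp_on :: "real \<Rightarrow> (real^'n) set \<Rightarrow> (real^'n \<Rightarrow> 'b::euclidean_space) \<Rightarrow> bool" where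
  "Lp_on p S f \<longleftrightarrow> f \<in> borel_measurable (lebesgue_on S) \<and>
     integrable (lebesgue_on S) (\<lambda>x. norm (f x) powr p)"

definition Lp_loc :: "real \<Rightarrow> (real^'n) set \<Rightarrow> (real^'n \<Rightarrow> 'b::euclidean_space) \<Rightarrow> bool" where
  "Lp_loc p \<Omega> f \<longleftrightarrow> (\<forall>K. compact K \<and> K \<subseteq> \<Omega> \<longrightarrow> Lp_on p K f)"

definition has_weak_gradient ::
    "(real^'n) set \<Rightarrow> (real^'n \<Rightarrow> real) \<Rightarrow> (real^'n \<Rightarrow> real^'n) \<Rightarrow> bool" where
  "has_weak_gradient \<Omega> u G \<longleftrightarrow> Lp_loc 1 \<Omega> u \<and> Lp_loc 1 \<Omega> G \<and>
     (\<forall>\<phi> i. test_function \<Omega> \<phi> \<longrightarrow>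
        (LINT x|lebesgue_on \<Omega>. u x * grad \<phi> x $ i) = - (LINT x|lebesgue_on \<Omega>. G x $ i * \<phi> x))"

text \<open>A weak gradient is unique up to a null set, so on weakly differentiable functions the choice
  below affects no integral over \<open>\<Omega>\<close>.\<close>

definition weak_grad :: "(real^'n) set \<Rightarrow> (real^'n \<Rightarrow> real) \<Rightarrow> real^'n \<Rightarrow> real^'n" where
  "weak_grad \<Omega> u = (SOME G. has_weak_gradient \<Omega> u G)"

definition W1p :: "real \<Rightarrow> (real^'n) set \<Rightarrow> (real^'n \<Rightarrow> real) \<Rightarrow> bool" where
  "W1p p \<Omega> u \<longleftrightarrow> Lp_on p \<Omega> u \<and> (\<exists>G. has_weak_gradient \<Omega> u G \<and> Lp_on p \<Omega> G)"

definition W1p_loc :: "real \<Rightarrow> (real^'n) set \<Rightarrow> (real^'n \<Rightarrow> real) \<Rightarrow> bool" where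
  "W1p_loc p \<Omega> u \<longleftrightarrow> Lp_loc p \<Omega> u \<and> (\<exists>G. has_weak_gradient \<Omega> u G \<and> Lp_loc p \<Omega> G)"

definition W1p_norm :: "real \<Rightarrow> (real^'n) set \<Rightarrow> (real^'n \<Rightarrow> real) \<Rightarrow> real" where
  "W1p_norm p \<Omega> u = ((LINT x|lebesgue_on \<Omega>. \<bar>u x\<bar> powr p) +
     (LINT x|lebesgue_on \<Omega>. norm (weak_grad \<Omega> u x) powr p)) powr (1 / p)"

definition W1p_0 :: "real \<Rightarrow> (real^'n) set \<Rightarrow> (real^'n \<Rightarrow> real) \<Rightarrow> bool" where
  "W1p_0 p \<Omega> u \<longleftrightarrow> W1p p \<Omega> u \<and>
     (\<forall>\<epsilon>>0. \<exists>\<phi>. test_function \<Omega> \<phi> \<and> W1p_norm p \<Omega> (\<lambda>x. u x - \<phi> x) < \<epsilon>)"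

definition p_harmonic :: "real \<Rightarrow> (real^'n) set \<Rightarrow> (real^'n \<Rightarrow> real) \<Rightarrow> bool" where
  "p_harmonic p \<Omega> H \<longleftrightarrow> continuous_on \<Omega> H \<and> W1p_loc p \<Omega> H \<and>
     (\<forall>\<phi>. test_function \<Omega> \<phi> \<longrightarrow>
        (LINT x|lebesgue_on \<Omega>.
           norm (weak_grad \<Omega> H x) powr (p - 2) * (weak_grad \<Omega> H x \<bullet> grad \<phi> x)) = 0)"

definition open_cube :: "(real^'n) set" where
  "open_cube = {x. \<forall>i. - 1 < x $ i \<and> x $ i < 1}"

end

(* The solution depends on two coordinates only and is homogeneous of degree 3/2. In terms of its
   gradient p = (a, b) with r = |p| it is 4 r (a^2 - b^2), at the point which is the gradient of
   2 r (a^2 - b^2) at p; this comes from the hodograph transformation, which linearizes the planar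
   7-harmonic equation. The map from the gradient to the point is, up to a reflection, strongly
   monotone with modulus |p| + |q|. Hence it has an inverse that is Hoelder continuous with exponent
   1/2, and the solution is convex in one variable and concave in the other, which gives monotonicity
   in the sense of Lebesgue. The flux r^5 p is the rotated gradient of a C^1 stream function
   -2 r^6 a b, so it is weakly divergence free also across the singular axis. Minimizers are unique
   by strict convexity and a Poincare inequality. On the line y = 0 the solution has x = 6 a |a|,
   so its gradient is not differentiable at 0; for n >= 3 the singular axis is not discrete. *)
theory Submission
  imports Defs "HOL-Computational_Algebra.Polynomial"
begin

subsection \<open>The planar solution in hodograph coordinates\<close>

text \<open>Why 7 and why 3/2: where the gradient is nonzero, the planar p-harmonic equation says
  u_tt + (p - 1) u_nn = 0, with n the gradient direction and t orthogonal to it. Interchanging point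
  and gradient inverts the Hessian, and in dimension two inversion swaps these second derivatives up
  to the determinant. So the dual F satisfies F_nn + (p - 1) F_tt = 0, which is linear, and r^m cos
  (k theta) solves it if and only if m (m - 1) + (p - 1) (m - k^2) = 0. For p = 7 and k = 2 the
  positive root is m = 3: the saddle function. Points then scale like r^2, so the gradient scales
  like the square root of the distance. The obstacle is the axis, where the gradient vanishes, the
  equation degenerates and the inverse map is not Lipschitz. Therefore no second derivative of the
  solution is ever taken. Potential and stream function are differentiated by first-order arguments,
  the equation is checked only in its weak form, and injectivity, Holder continuity and the
  convexity properties all come from the one degenerate estimate with modulus
  \<open>norm p + norm q\<close>.\<close>

text \<open>The gradient of the saddle function \<open>2 * norm p * (a\<^sup>2 - b\<^sup>2)\<close> at \<open>p = (a, b)\<close>. In complex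
  notation it is the conjugate of \<open>5 * \<bar>p\<bar> * p + (cnj p)\<^sup>3 / \<bar>p\<bar>\<close>, a solution of the linear equation
  obtained from the 7-harmonic equation by interchanging point and gradient. At \<open>p = 0\<close> the
  quotients are \<open>0 / 0 = 0\<close>.\<close>

definition legendre :: "real \<times> real \<Rightarrow> real \<times> real" where
  "legendre p = (2 * norm p * fst p + 4 * fst p ^ 3 / norm p,
            - (2 * norm p * snd p + 4 * snd p ^ 3 / norm p))"

text \<open>The reflection \<open>(x, y) \<mapsto> (x, - y)\<close> turns the gradient of the saddle function into a monotone map.\<close>

definition hodo :: "real \<times> real \<Rightarrow> real \<times> real" where
  "hodo p = (2 * norm p * fst p + 4 * fst p ^ 3 / norm p,
             2 * norm p * snd p + 4 * snd p ^ 3 / norm p)"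

lemma legendre_hodo: "legendre p = (fst (hodo p), - snd (hodo p))"
  by (simp add: legendre_def hodo_def)

section \<open>Strong monotonicity of the reflected map\<close>

lemma norm_sq_pair: "norm (p::real\<times>real) ^ 2 = fst p ^ 2 + snd p ^ 2"
  by (cases p) (simp add: norm_Pair)

text \<open>\<open>norm p *\<^sub>R p\<close> is the gradient of a third of the cubed norm. This
  term alone supplies the modulus \<open>norm p + norm q\<close> of \<open>hodo\<close>; the other
  term need only be monotone.\<close>

lemma norm_scaleR_pos_mono:
  fixes p q :: "'a::real_inner"
  shows "(norm p + norm q) / 2 * norm (p - q) ^ 2 \<le> (norm p *\<^sub>R p - norm q *\<^sub>R q) \<bullet> (p - q)"
proof -
  have n: "norm (p - q) ^ 2 = norm p ^ 2 + norm q ^ 2 - 2 * (p \<bullet> q)"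
    by (simp add: power2_norm_eq_inner inner_diff_left inner_diff_right inner_commute)
  have "(norm p *\<^sub>R p - norm q *\<^sub>R q) \<bullet> (p - q) - (norm p + norm q) / 2 * norm (p - q) ^ 2
     = (norm p - norm q)^2 * (norm p + norm q) / 2"
    unfolding n
    by (simp add: inner_diff_left inner_diff_right inner_commute[of q p] power2_norm_eq_inner[symmetric])
       (simp add: field_simps power2_eq_square power3_eq_cube)
  moreover have "0 \<le> (norm p - norm q)^2 * (norm p + norm q) / 2" by simp
  ultimately show ?thesis by linarith
qed

text \<open>The anisotropic part of \<open>hodo\<close>, which is \<open>2 * norm p\<close> times
  \<open>p\<close> plus 4 times this. It is not curl free, hence not the gradient of a convex
  function, and its monotonicity has to be read off the quadratic form of its derivative.\<close>

definition cub :: "real \<times> real \<Rightarrow> real \<times> real" where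
  "cub p = (fst p ^ 3 / norm p, snd p ^ 3 / norm p)"

lemma cub_inner_nonneg: "cub p \<bullet> p \<ge> 0"
proof -
  have "cub p \<bullet> p = (fst p ^ 4 + snd p ^ 4) / norm p"
    by (cases p) (simp add: cub_def power_numeral_reduce add_divide_distrib algebra_simps)
  then show ?thesis by simp
qed

lemma cub_scaleR: "cub (t *\<^sub>R v) = (t * \<bar>t\<bar>) *\<^sub>R cub v"
proof (cases "t = 0")
  case False
  obtain a b where v: "v = (a, b)" by (cases v)
  have "norm (t * a, t * b) = \<bar>t\<bar> * norm (a, b)"
    using norm_scaleR[of t "(a, b)"] by simp
  then show ?thesis
    using False by (cases "t < 0") (simp_all add: v cub_def power3_eq_cube abs_if)
qed (simp add: cub_def zero_prod_def)

text \<open>The expression is the quotient rule applied to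
  \<open>cub (p + t *\<^sub>R v) \<bullet> v\<close> at t = 0, for p = (a, b), v = (u, w) and
  \<open>r\<close> the norm of p; \<open>inverse r / 2\<close> comes from the square root. Clearing
  \<open>inverse r\<close> exhibits a sum of squares.\<close>

lemma cub_derivative_nonneg:
  fixes a b u w r :: real
  assumes r: "r > 0" "r^2 = a^2 + b^2"
  shows "0 \<le> ((3*a^2*u*u + 3*b^2*w*w) * r
    - (a^3*u + b^3*w) * (inverse r / 2 * (2*a*u + 2*b*w))) / (r*r)"
proof -
  have i: "r * inverse r = 1" using r by simp
  have "r^2 * ((3*a^2*u*u + 3*b^2*w*w) * r - (a^3*u + b^3*w) * (inverse r / 2 * (2*a*u + 2*b*w)))
    = r * ((3*a^2*u*u + 3*b^2*w*w) * r^2 - (a^3*u + b^3*w) * (a*u + b*w))"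
    using i by algebra
  moreover have "(3*a^2*u*u + 3*b^2*w*w) * r^2 - (a^3*u + b^3*w) * (a*u + b*w)
    = (a^2+b^2) * ((a*u)^2 + (b*w)^2 + ((a*u - b*w)^2 + (a*u)^2 + (b*w)^2) / 2) + a^2*b^2*(u^2+w^2)"
    unfolding r(2) by algebra
  moreover have "\<dots> \<ge> 0" by simp
  ultimately have "0 \<le> r^2 * ((3*a^2*u*u + 3*b^2*w*w) * r
      - (a^3*u + b^3*w) * (inverse r / 2 * (2*a*u + 2*b*w)))"
    using r(1) by simp
  then show ?thesis using r(1) by (simp add: zero_le_mult_iff)
qed

lemma cub_mono: "(cub p - cub q) \<bullet> (p - q) \<ge> 0"
\<comment> \<open>\<open>cub\<close> is not differentiable at the origin, so segments through it are
  treated apart. There \<open>p\<close> and \<open>q\<close> are multiples of one vector with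
  opposite signs, and quadratic homogeneity reduces the claim to
  \<open>cub_inner_nonneg\<close>.\<close>
proof (cases "\<exists>t\<in>{0..1}. q + t *\<^sub>R (p - q) = 0")
  case True
  then obtain t where t: "0 \<le> t" "t \<le> 1" "q + t *\<^sub>R (p - q) = 0" by auto
  define v where "v = p - q"
  have q: "q = (-t) *\<^sub>R v" using t(3) by (simp add: v_def eq_neg_iff_add_eq_0)
  have p: "p = (1 - t) *\<^sub>R v" using q by (simp add: v_def algebra_simps)
  have "(cub p - cub q) \<bullet> v = ((1-t)*\<bar>1-t\<bar> + t * \<bar>t\<bar>) * (cub v \<bullet> v)"
    unfolding p q cub_scaleR by (simp add: inner_diff_left algebra_simps)
  then show ?thesis using t cub_inner_nonneg[of v] by (simp add: v_def[symmetric])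
next
  case False
  obtain u w where v: "p - q = (u, w)" by (cases "p - q")
  obtain a0 b0 where q: "q = (a0, b0)" by (cases q)
  \<comment> \<open>\<open>cub\<close> along the segment, tested against the direction of the
    segment. Its derivative is the quadratic form of \<open>cub_derivative_nonneg\<close>.\<close>
  define h where "h = (\<lambda>t. ((a0 + t*u)^3 * u + (b0 + t*w)^3 * w) / sqrt ((a0+t*u)^2 + (b0+t*w)^2))"
  have h: "h t = cub (q + t *\<^sub>R (p - q)) \<bullet> (p - q)" for t
    unfolding v by (simp add: h_def cub_def q norm_Pair add_divide_distrib)
  have "h 0 \<le> h 1"
  proof (rule DERIV_nonneg_imp_nondecreasing[of 0 1 h])
    fix t :: real assume t: "0 \<le> t" "t \<le> 1"
    define a b r where "a = a0 + t*u" and "b = b0+t*w" and "r = sqrt (a^2+b^2)"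
    have "(a,b) \<noteq> 0" using False t v q by (auto simp: a_def b_def)
    then have pos: "a^2+b^2 > 0" by (auto simp: zero_prod_def sum_power2_gt_zero_iff)
    then have r: "r > 0" "r^2 = a^2+b^2" by (auto simp: r_def)
    have "((\<lambda>t. (a0 + t*u)^3 * u + (b0 + t*w)^3 * w) has_real_derivative 3*a^2*u*u + 3*b^2*w*w) (at t)"
      unfolding a_def b_def by (rule derivative_eq_intros refl)+ (simp add: power2_eq_square)
    moreover have "((\<lambda>t. (a0+t*u)^2 + (b0+t*w)^2) has_real_derivative 2*a*u + 2*b*w) (at t)"
      unfolding a_def b_def by (rule derivative_eq_intros refl)+ (simp add: algebra_simps)
    then have "((\<lambda>t. sqrt ((a0+t*u)^2 + (b0+t*w)^2)) has_real_derivative inverse r / 2 * (2*a*u + 2*b*w)) (at t)"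
      using pos unfolding r_def a_def b_def by (intro DERIV_chain2[OF DERIV_real_sqrt]) auto
    ultimately have "(h has_real_derivative ((3*a^2*u*u + 3*b^2*w*w) * r
        - (a^3*u + b^3*w) * (inverse r / 2 * (2*a*u + 2*b*w))) / (r*r)) (at t)"
      unfolding h_def using r(1) unfolding r_def a_def b_def by (intro DERIV_divide) auto
    then show "\<exists>y. DERIV h t :> y \<and> 0 \<le> y"
      using cub_derivative_nonneg[OF r] by blast
  qed simp
  then show ?thesis unfolding h by (simp add: inner_diff_left)
qed

lemma hodo_strong_mono: "(norm p + norm q) * norm (p - q) ^ 2 \<le> (hodo p - hodo q) \<bullet> (p - q)"
proof -
  have "hodo p = 2 *\<^sub>R (norm p *\<^sub>R p) + 4 *\<^sub>R cub p" for p
    by (cases p) (simp add: hodo_def cub_def)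
  then have "(hodo p - hodo q) \<bullet> (p - q)
     = 2 * ((norm p *\<^sub>R p - norm q *\<^sub>R q) \<bullet> (p - q)) + 4 * ((cub p - cub q) \<bullet> (p - q))"
    by (simp add: inner_diff_left inner_add_left algebra_simps)
  then show ?thesis using norm_scaleR_pos_mono[of p q] cub_mono[of p q] by linarith
qed

section \<open>Bijectivity of the hodograph map and its inverse\<close>

lemma hodo_surj_nonneg:
  assumes "0 \<le> x" "0 \<le> y"
  shows "\<exists>p. hodo p = (x, y)"
proof -
  \<comment> \<open>On the ray at angle t the map is \<open>r^2\<close> times
    \<open>(?m (cos t), ?m (sin t))\<close>. The angle is found by an intermediate value argument
    for the ratio of the coordinates, cross-multiplied so that vanishing coordinates need no
    exception.\<close>
  let ?m = "\<lambda>c. 2 * c + 4 * c ^ 3 :: real"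
  have "\<exists>t\<ge>0. t \<le> pi/2 \<and> x * ?m (sin t) - y * ?m (cos t) = 0"
    using assms by (intro IVT') (auto intro!: continuous_intros)
  then obtain t where t: "0 \<le> t" "t \<le> pi/2" "x * ?m (sin t) = y * ?m (cos t)" by auto
  define c s where "c = cos t" and "s = sin t"
  have cs: "c^2+s^2 = 1" "c \<ge> 0" "s \<ge> 0"
    using t by (auto simp: c_def s_def intro!: cos_ge_zero sin_ge_zero)
  have pos: "?m c + ?m s > 0"
  proof -
    have "c > 0 \<or> s > 0" using cs by (metis add_0 le_less power_zero_numeral zero_neq_one)
    moreover have "0 \<le> c ^ 3" "0 \<le> s ^ 3" using cs by auto
    ultimately show ?thesis using cs by linarith
  qed
  \<comment> \<open>Adding the two coordinate equations determines the radius: the sum of the two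
    values of \<open>?m\<close> is positive on the whole quadrant, while a single one may
    vanish.\<close>
  define r where "r = sqrt ((x+y) / (?m c + ?m s))"
  have r: "r \<ge> 0" "r^2 = (x+y) / (?m c + ?m s)" using assms pos by (auto simp: r_def)
  have e: "x * ?m s = y * ?m c" using t by (simp add: c_def s_def)
  have 1: "r^2 * ?m c = x"
    using pos e unfolding r(2) by (simp add: divide_eq_eq) (simp add: algebra_simps)
  have 2: "r^2 * ?m s = y"
    using pos e unfolding r(2) by (simp add: divide_eq_eq) (simp add: algebra_simps)
  have n: "norm (r*c, r * s) = r"
    using r(1) cs(1) by (simp add: norm_Pair power_mult_distrib flip: distrib_left)
  have "hodo (r*c,r * s) = (r^2 * ?m c, r^2 * ?m s)"
    unfolding hodo_def n using r(1) by (cases "r = 0") (simp_all add: field_simps power2_eq_square power3_eq_cube)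
  then show ?thesis using 1 2 by auto
qed

lemma legendre_surj: "\<exists>p. legendre p = z"
proof -
  obtain x y where z: "z = (x,y)" by (cases z)
  obtain a b where ab: "hodo (a,b) = (\<bar>x\<bar>, \<bar>y\<bar>)"
    using hodo_surj_nonneg[of "\<bar>x\<bar>" "\<bar>y\<bar>"] by auto
  \<comment> \<open>Both components are odd in their own variable and even in the other, so signs
    can be restored afterwards. The branches for y are interchanged because \<open>legendre\<close>
    negates the second component.\<close>
  have "legendre ((if x < 0 then -a else a), (if y < 0 then b else -b)) = z"
    using ab by (auto simp: z legendre_def hodo_def norm_Pair split: if_splits)
  then show ?thesis by blast
qed

text \<open>Cauchy-Schwarz removes one factor from strong monotonicity, and the reflection is an
  isometry. The modulus degenerates only at the origin, so the inverse is locally Lipschitz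
  elsewhere and Holder with exponent 1/2 across it.\<close>

lemma legendre_expand: "(norm p + norm q) * norm (p - q) \<le> norm (legendre p - legendre q)"
proof (cases "p = q")
  case False
  have "(norm p + norm q) * norm (p - q) ^ 2 \<le> norm (hodo p - hodo q) * norm (p - q)"
    using hodo_strong_mono[of p q] norm_cauchy_schwarz[of "hodo p - hodo q" "p - q"] by linarith
  then have "(norm p + norm q) * norm (p - q) \<le> norm (hodo p - hodo q)"
    using False by (simp add: power2_eq_square)
  moreover have "norm (legendre p - legendre q) = norm (hodo p - hodo q)"
    unfolding legendre_hodo by (cases "hodo p"; cases "hodo q") (simp add: norm_Pair power2_commute)
  ultimately show ?thesis by simp
qed simp

lemma legendre_inj: "legendre p = legendre q \<Longrightarrow> p = q"
proof -
  assume "legendre p = legendre q"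
  then have "(norm p + norm q) * norm (p - q) \<le> 0" using legendre_expand[of p q] by simp
  then show "p = q"
    by (metis add_nonneg_nonneg diff_0_right mult_eq_0_iff norm_ge_zero norm_le_zero_iff
        add_nonneg_eq_0_iff mult_nonneg_nonneg order_antisym right_minus_eq)
qed

definition legendre_inv :: "real \<times> real \<Rightarrow> real \<times> real" where
  "legendre_inv = inv legendre"

lemma legendre_legendre_inv [simp]: "legendre (legendre_inv z) = z"
  unfolding legendre_inv_def by (metis legendre_surj f_inv_into_f rangeI)

lemma legendre_inv_legendre [simp]: "legendre_inv (legendre p) = p"
  by (rule legendre_inj) simp

lemma legendre_inv_contract:
  "(norm (legendre_inv z) + norm (legendre_inv z')) * norm (legendre_inv z - legendre_inv z') \<le> norm (z - z')"
  using legendre_expand[of "legendre_inv z" "legendre_inv z'"] by simp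

lemma legendre_inv_hoelder: "norm (legendre_inv z - legendre_inv z') ^ 2 \<le> norm (z - z')"
proof -
  \<comment> \<open>The modulus itself dominates the distance by the triangle inequality, which
    yields the square.\<close>
  have "norm (legendre_inv z - legendre_inv z') * norm (legendre_inv z - legendre_inv z') \<le>
     (norm (legendre_inv z) + norm (legendre_inv z')) * norm (legendre_inv z - legendre_inv z')"
    by (intro mult_right_mono norm_triangle_ineq4) auto
  then show ?thesis using legendre_inv_contract[of z z'] by (simp add: power2_eq_square)
qed

text \<open>A change of x alone changes \<open>hodo\<close> by \<open>(x - x', 0)\<close>, so strong
  monotonicity speaks of first components only. Since \<open>legendre_inv\<close> is the gradient of
  the potential, this amounts to convexity in x; the reflected second coordinate gives concavity in
  y.\<close>

lemma legendre_inv_mono_fst: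
  assumes "x \<le> x'"
  shows "fst (legendre_inv (x, y)) \<le> fst (legendre_inv (x', y))"
proof (rule ccontr)
  assume c: "\<not> ?thesis"
  define p q where "p = legendre_inv (x, y)" and "q = legendre_inv (x', y)"
  have "hodo p - hodo q = (x - x', 0)"
    using legendre_legendre_inv[of "(x,y)"] legendre_legendre_inv[of "(x',y)"]
    unfolding p_def[symmetric] q_def[symmetric] legendre_hodo
    by (cases "hodo p"; cases "hodo q") auto
  then have "(norm p + norm q) * norm (p - q) ^ 2 \<le> (x - x') * (fst p - fst q)"
    using hodo_strong_mono[of p q] by (cases p; cases q) simp
  also have "\<dots> \<le> 0" using c assms by (simp add: p_def q_def mult_nonpos_nonneg)
  finally have "p = q \<or> norm p + norm q \<le> 0"
    by (smt (verit, best) mult_pos_pos norm_eq_zero right_minus_eq zero_less_power norm_ge_zero)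
  then have "p = q" by (metis add_nonneg_eq_0_iff norm_eq_zero norm_ge_zero add_nonneg_nonneg order_antisym)
  then show False using c by (simp add: p_def q_def)
qed

lemma legendre_inv_antimono_snd:
  assumes "y \<le> y'"
  shows "snd (legendre_inv (x, y')) \<le> snd (legendre_inv (x, y))"
proof (rule ccontr)
  assume c: "\<not> ?thesis"
  define p q where "p = legendre_inv (x, y)" and "q = legendre_inv (x, y')"
  have "hodo p - hodo q = (0, y' - y)"
    using legendre_legendre_inv[of "(x,y)"] legendre_legendre_inv[of "(x,y')"]
    unfolding p_def[symmetric] q_def[symmetric] legendre_hodo
    by (cases "hodo p"; cases "hodo q") auto
  then have "(norm p + norm q) * norm (p - q) ^ 2 \<le> (y' - y) * (snd p - snd q)"
    using hodo_strong_mono[of p q] by (cases p; cases q) simp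
  also have "\<dots> \<le> 0" using c assms by (simp add: p_def q_def mult_nonneg_nonpos)
  finally have "p = q \<or> norm p + norm q \<le> 0"
    by (smt (verit, best) mult_pos_pos norm_eq_zero right_minus_eq zero_less_power norm_ge_zero)
  then have "p = q" by (metis add_nonneg_eq_0_iff norm_eq_zero norm_ge_zero add_nonneg_nonneg order_antisym)
  then show False using c by (simp add: p_def q_def)
qed

lemma legendre_inv_0 [simp]: "legendre_inv 0 = 0"
proof -
  have "legendre 0 = 0" by (simp add: legendre_def zero_prod_def)
  then show ?thesis by (metis legendre_inv_legendre)
qed

lemma legendre_inv_nonzero: "z \<noteq> 0 \<Longrightarrow> legendre_inv z \<noteq> 0"
  by (metis legendre_inv_0 legendre_legendre_inv)

lemma norm_legendre_inv_sq: "norm (legendre_inv z) ^ 2 \<le> norm z"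
  using legendre_inv_hoelder[of z 0] by simp

lemma continuous_legendre_inv: "continuous_on UNIV legendre_inv"
  unfolding continuous_on_iff dist_norm
proof (intro ballI allI impI)
  fix z :: "real\<times>real" and e :: real assume "e > 0"
  have "norm (legendre_inv z' - legendre_inv z) < e" if "norm (z' - z) < e^2" for z'
    using legendre_inv_hoelder[of z' z] that \<open>e > 0\<close> by (metis le_less_trans power_less_imp_less_base less_imp_le)
  then show "\<exists>d>0. \<forall>x'\<in>UNIV. norm (x' - z) < d \<longrightarrow> norm (legendre_inv x' - legendre_inv z) < e"
    using \<open>e > 0\<close> by (metis zero_less_power)
qed

text \<open>A Lipschitz right inverse \<open>g\<close> of \<open>\<Phi>\<close> need not be differentiated: \<open>k - N \<bullet> \<Phi>\<close> is stationary at \<open>g z\<close>,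
  and \<open>\<Phi> (g z) = z\<close>.\<close>

lemma has_derivative_compose_inverse:
  fixes \<Phi> :: "'a::real_normed_vector \<Rightarrow> 'b::real_inner"
  assumes \<Phi>: "(\<Phi> has_derivative D) (at (g z))"
    and k: "(k has_derivative (\<lambda>v. N \<bullet> D v)) (at (g z))"
    and inv: "\<And>z. \<Phi> (g z) = z"
    and lip: "\<And>z'. norm (g z' - g z) \<le> C * norm (z' - z)"
  shows "((\<lambda>z. k (g z)) has_derivative (\<lambda>h. N \<bullet> h)) (at z)"
proof -
  define e where "e = (\<lambda>p. k p - N \<bullet> \<Phi> p)"
  have "(e has_derivative (\<lambda>v. 0)) (at (g z))"
    unfolding e_def by (rule derivative_eq_intros \<Phi> k refl | simp)+
  then have e: "\<forall>\<epsilon>>0. \<exists>d>0. \<forall>p. norm (p - g z) < d \<longrightarrow> norm (e p - e (g z)) \<le> \<epsilon> * norm (p - g z)"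
    by (simp add: has_derivative_at_alt)
  \<comment> \<open>Enlarging the constant makes it positive, so that it can be divided by.\<close>
  define C' where "C' = max C 1"
  have C': "C' > 0" "norm (g z' - g z) \<le> C' * norm (z' - z)" for z'
    using lip[of z'] mult_right_mono[of C C' "norm (z' - z)"] by (auto simp: C'_def)
  show ?thesis
    unfolding has_derivative_at_alt
  proof (intro conjI allI impI)
    show "bounded_linear ((\<bullet>) N)" by (rule bounded_linear_inner_right)
    fix \<epsilon> :: real assume "\<epsilon> > 0"
    then have "\<epsilon> / C' > 0" using C' by simp
    then obtain d where d: "d > 0" "\<And>p. norm (p - g z) < d \<Longrightarrow> norm (e p - e (g z)) \<le> \<epsilon> / C' * norm (p - g z)"
      using e by blast
    show "\<exists>d>0. \<forall>y. norm (y - z) < d \<longrightarrow> norm (k (g y) - k (g z) - N \<bullet> (y - z)) \<le> \<epsilon> * norm (y - z)"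
    proof (intro exI[of _ "d / C'"] conjI allI impI)
      show "d / C' > 0" using d C' by simp
      fix y assume "norm (y - z) < d / C'"
      then have "norm (g y - g z) < d" using C'(1) C'(2)[of y] by (simp add: field_simps)
      then have "norm (e (g y) - e (g z)) \<le> \<epsilon> / C' * norm (g y - g z)" by (rule d(2))
      also have "\<dots> \<le> \<epsilon> / C' * (C' * norm (y - z))"
        using C' \<open>\<epsilon> > 0\<close> by (intro mult_left_mono) auto
      finally show "norm (k (g y) - k (g z) - N \<bullet> (y - z)) \<le> \<epsilon> * norm (y - z)"
        using C' by (simp add: e_def inv inner_diff_right algebra_simps)
    qed
  qed
qed

section \<open>Potential and stream function under the Legendre transformation\<close>

lemma pot_legendre_identity:
  fixes a b u w r i q :: real
  assumes "r*i = 1" "r^2 = a^2+b^2" "q = (a*u+b*w) * i"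
  shows "4 * q * (a^2 - b^2) + 4 * r * (2*a*u - 2*b*w)
       = a * (2*q*a + 2*r*u + 12*a^2*u*i - 4*a^3*q*i^2)
          - b * (2*q*b + 2*r*w + 12*b^2*w*i - 4*b^3*q*i^2)"
proof -
  have 1: "r * q = a*u+b*w" using assms by algebra
  have 2: "(a^4 - b^4) * i^2 = a^2 - b^2" using assms(1,2) by algebra
  have 3: "12*(a^3*u - b^3*w) * i = 6 * (a^2-b^2)*q + 6*r*(a*u-b*w)" using assms by algebra
  show ?thesis using 2 3 by algebra
qed
lemma stream_legendre_identity:
  fixes a b u w r i q :: real
  assumes "r*i = 1" "r^2 = a^2+b^2" "q = (a*u+b*w) * i"
  shows "- 12 * q * a * b - 2 * r * (u * b + a * w)
       = - b * (2*q*a + 2*r*u + 12*a^2*u*i - 4*a^3*q*i^2)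
          - a * (2*q*b + 2*r*w + 12*b^2*w*i - 4*b^3*q*i^2)"
proof -
  have 2: "(a^2 + b^2) * i^2 = 1" using assms(1,2) by algebra
  show ?thesis using 2 assms(3) by algebra
qed

text \<open>Written with \<open>i\<close>, the reciprocal norm, and \<open>q\<close>, the derivative
  of the norm in direction \<open>v\<close>. In these variables the chain rule for potential and
  stream function becomes the two polynomial identities above, modulo \<open>r * i = 1\<close> and
  \<open>r^2 = a^2 + b^2\<close>.\<close>

definition legendre_deriv :: "real \<times> real \<Rightarrow> real \<times> real \<Rightarrow> real \<times> real" where
  "legendre_deriv p v = (let r = norm p; i = inverse r; q = (p \<bullet> v) * i in
     (2 * q * fst p + 2 * r * fst v + 12 * (fst p)^2 * fst v * i - 4 * (fst p)^3 * q * i^2,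
      - (2 * q * snd p + 2 * r * snd v + 12 * (snd p)^2 * snd v * i - 4 * (snd p)^3 * q * i^2)))"

lemma has_derivative_norm_pair:
  assumes "p \<noteq> 0"
  shows "((norm :: 'a::real_inner \<Rightarrow> real) has_derivative (\<lambda>v. p \<bullet> v / norm p)) (at p)"
  using has_derivative_norm[OF assms] by (rule has_derivative_eq_rhs) (auto simp: sgn_div_norm inner_commute divide_inverse)

lemma legendre_has_derivative:
  assumes "p \<noteq> 0"
  shows "(legendre has_derivative legendre_deriv p) (at p)"
proof -
  have n: "norm p \<noteq> 0" using assms by simp
  show ?thesis
    unfolding legendre_def[abs_def]
    apply (rule has_derivative_eq_rhs)
     apply (rule derivative_intros has_derivative_norm_pair[OF assms] n)+
    by (auto simp: legendre_deriv_def Let_def divide_inverse power2_eq_square power3_eq_cube algebra_simps)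
qed

text \<open>The Legendre conjugate \<open>p \<bullet> legendre p - S p\<close> of the saddle
  function \<open>S\<close>: as \<open>S\<close> is homogeneous of degree 3, Euler's relation turns
  this into \<open>2 * S p\<close>.\<close>

definition pot :: "real \<times> real \<Rightarrow> real" where
  "pot p = 4 * norm p * ((fst p)^2 - (snd p)^2)"

text \<open>In the variables \<open>(x, y) = legendre p\<close>, the potential has gradient \<open>p\<close>, and the stream function has
  gradient \<open>norm p ^ 5 * (- b, a)\<close>, which is the flux of the 7-Laplacian rotated by a right angle.\<close>

definition stream :: "real \<times> real \<Rightarrow> real" where
  "stream p = - 2 * norm p ^ 6 * fst p * snd p"

lemma pot_has_derivative:
  assumes "p \<noteq> 0"
  shows "(pot has_derivative (\<lambda>v. p \<bullet> legendre_deriv p v)) (at p)"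
proof -
  obtain a b where p: "p = (a,b)" by (cases p)
  have "(pot has_derivative (\<lambda>v. 4 * (p \<bullet> v / norm p) * ((fst p)^2 - (snd p)^2)
      + 4 * norm p * (2 * fst p * fst v - 2 * snd p * snd v))) (at p)"
    unfolding pot_def[abs_def]
    apply (rule has_derivative_eq_rhs)
     apply (rule derivative_intros has_derivative_norm_pair[OF assms])+
    by (auto simp: algebra_simps)
  moreover have "4 * (p \<bullet> v / norm p) * ((fst p)^2 - (snd p)^2)
      + 4 * norm p * (2 * fst p * fst v - 2 * snd p * snd v) = p \<bullet> legendre_deriv p v" for v
  proof -
    obtain u w where v: "v = (u,w)" by (cases v)
    define r where "r = norm p"
    have "r * inverse r = 1" "r^2 = a^2+b^2" using assms norm_sq_pair[of p] by (auto simp: r_def p)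
    note pot_legendre_identity[OF this refl, of u w]
    then show ?thesis
      unfolding legendre_deriv_def Let_def v r_def[symmetric]
      by (simp add: p divide_inverse) (simp add: algebra_simps)
  qed
  ultimately show ?thesis by (simp only:)
qed

lemma stream_has_derivative:
  assumes "p \<noteq> 0"
  shows "(stream has_derivative (\<lambda>v. (- (norm p ^ 5) * snd p, norm p ^ 5 * fst p) \<bullet> legendre_deriv p v)) (at p)"
proof -
  obtain a b where p: "p = (a,b)" by (cases p)
  have "(stream has_derivative (\<lambda>v. - 12 * norm p ^ 5 * (p \<bullet> v / norm p) * fst p * snd p
      - 2 * norm p ^ 6 * (fst v * snd p + fst p * snd v))) (at p)"
    unfolding stream_def[abs_def]
    apply (rule has_derivative_eq_rhs)
     apply (rule derivative_intros has_derivative_norm_pair[OF assms])+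
    by (auto simp: algebra_simps)
  moreover have "- 12 * norm p ^ 5 * (p \<bullet> v / norm p) * fst p * snd p
      - 2 * norm p ^ 6 * (fst v * snd p + fst p * snd v)
      = (- (norm p ^ 5) * snd p, norm p ^ 5 * fst p) \<bullet> legendre_deriv p v" for v
  proof -
    obtain u w where v: "v = (u,w)" by (cases v)
    define r where "r = norm p"
    have "r * inverse r = 1" "r^2 = a^2+b^2" using assms norm_sq_pair[of p] by (auto simp: r_def p)
    \<comment> \<open>All terms share the factor \<open>r^5\<close>, which was cancelled in
      \<open>stream_legendre_identity\<close>.\<close>
    note arg_cong[OF stream_legendre_identity[OF this refl, of u w], of "(*) (r^5)"]
    then show ?thesis
      unfolding legendre_deriv_def Let_def v r_def[symmetric]
      by (simp add: p divide_inverse power_numeral_reduce algebra_simps)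
  qed
  ultimately show ?thesis by (simp only:)
qed

text \<open>The inverse grows at most like a square root, so a cubic bound in the gradient is of
  order 3/2 in the point, hence superlinear. This replaces the chain rule at the one point where the
  inverse is not Lipschitz.\<close>

lemma has_derivative_compose_legendre_inv_0:
  assumes "\<And>p. norm p \<le> 1 \<Longrightarrow> \<bar>k p\<bar> \<le> 4 * norm p ^ 3"
  shows "((\<lambda>z. k (legendre_inv z)) has_derivative (\<lambda>h. 0)) (at 0)"
  unfolding has_derivative_at_alt
proof (intro conjI allI impI)
  fix \<epsilon> :: real assume "\<epsilon> > 0"
  \<comment> \<open>The 1 keeps the gradient in the unit ball, where the cubic bound is assumed; the
    other term makes \<open>4 * norm p\<close> at most \<open>\<epsilon>\<close>.\<close>
  define m where "m = min 1 (\<epsilon>/4)"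
  have m: "m > 0" "m \<le> 1" "4 * m \<le> \<epsilon>" using \<open>\<epsilon> > 0\<close> by (auto simp: m_def)
  have k0: "k 0 = 0" using assms[of 0] by simp
  show "\<exists>d>0. \<forall>y. norm (y - 0) < d \<longrightarrow> norm (k (legendre_inv y) - k (legendre_inv 0) - 0) \<le> \<epsilon> * norm (y - 0)"
  proof (intro exI[of _ "m^2"] conjI allI impI)
    fix y :: "real\<times>real" assume "norm (y - 0) < m^2"
    then have "norm (legendre_inv y) ^ 2 < m^2" using norm_legendre_inv_sq[of y] by simp
    then have n: "norm (legendre_inv y) < m" using m(1) by (simp add: power_less_imp_less_base)
    have "\<bar>k (legendre_inv y)\<bar> \<le> 4 * norm (legendre_inv y) * norm (legendre_inv y) ^ 2"
      using assms[of "legendre_inv y"] n m by (simp add: power2_eq_square power3_eq_cube)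
    also have "\<dots> \<le> (4 * m) * norm y"
      using n norm_legendre_inv_sq[of y] m by (intro mult_mono) auto
    also have "\<dots> \<le> \<epsilon> * norm y" using m by (intro mult_right_mono) auto
    finally show "norm (k (legendre_inv y) - k (legendre_inv 0) - 0) \<le> \<epsilon> * norm (y - 0)"
      by (simp add: k0)
  qed (use m in auto)
qed simp

text \<open>At a point off the origin the inverse satisfies a Lipschitz bound with constant
  \<open>1 / norm (legendre_inv z)\<close>. This blows up at the origin, where the cubic bound takes
  over; the derivative found there is zero, in agreement with \<open>N 0 = 0\<close>.\<close>

lemma has_derivative_compose_legendre_inv:
  assumes "\<And>p. p \<noteq> 0 \<Longrightarrow> (k has_derivative (\<lambda>v. N p \<bullet> legendre_deriv p v)) (at p)"
    and "\<And>p. norm p \<le> 1 \<Longrightarrow> \<bar>k p\<bar> \<le> 4 * norm p ^ 3" and "N 0 = 0"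
  shows "((\<lambda>z. k (legendre_inv z)) has_derivative (\<lambda>h. N (legendre_inv z) \<bullet> h)) (at z)"
proof (cases "z = 0")
  case True
  then show ?thesis using has_derivative_compose_legendre_inv_0[OF assms(2)] by (simp add: assms(3))
next
  case False
  then have nz: "legendre_inv z \<noteq> 0" by (rule legendre_inv_nonzero)
  show ?thesis
  proof (rule has_derivative_compose_inverse[OF legendre_has_derivative[OF nz] assms(1)[OF nz] legendre_legendre_inv])
    fix z'
    have "norm (legendre_inv z) * norm (legendre_inv z' - legendre_inv z) \<le> (norm (legendre_inv z') + norm (legendre_inv z)) * norm (legendre_inv z' - legendre_inv z)"
      by (intro mult_right_mono) auto
    also have "\<dots> \<le> norm (z' - z)" by (rule legendre_inv_contract)
    finally show "norm (legendre_inv z' - legendre_inv z) \<le> (1 / norm (legendre_inv z)) * norm (z' - z)"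
      using nz by (simp add: field_simps)
  qed
qed

lemma pot_legendre_inv_has_derivative:
  "((\<lambda>z. pot (legendre_inv z)) has_derivative (\<lambda>h. legendre_inv z \<bullet> h)) (at z)"
proof (rule has_derivative_compose_legendre_inv[where N = "\<lambda>p. p"])
  fix p :: "real\<times>real"
  have "\<bar>(fst p)^2 - (snd p)^2\<bar> \<le> norm p ^ 2"
    using zero_le_power2[of "fst p"] zero_le_power2[of "snd p"] unfolding norm_sq_pair by linarith
  then show "\<bar>pot p\<bar> \<le> 4 * norm p ^ 3"
    unfolding pot_def by (simp add: abs_mult power3_eq_cube power2_eq_square mult_left_mono)
qed (use pot_has_derivative in auto)

lemma stream_legendre_inv_has_derivative:
  "((\<lambda>z. stream (legendre_inv z)) has_derivative
     (\<lambda>h. norm (legendre_inv z) ^ 5 * (fst (legendre_inv z) * snd h - snd (legendre_inv z) * fst h))) (at z)"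
proof -
  let ?N = "\<lambda>p. (- (norm p ^ 5) * snd p, norm p ^ 5 * fst p)"
  have "((\<lambda>z. stream (legendre_inv z)) has_derivative (\<lambda>h. ?N (legendre_inv z) \<bullet> h)) (at z)"
  proof (rule has_derivative_compose_legendre_inv[where N = ?N])
    fix p :: "real\<times>real" assume n: "norm p \<le> 1"
    have 1: "\<bar>fst p\<bar> \<le> norm p" "\<bar>snd p\<bar> \<le> norm p"
      using norm_fst_le[of "fst p" "snd p"] norm_snd_le[of "snd p" "fst p"] by auto
    have "\<bar>stream p\<bar> = 2 * norm p ^ 6 * \<bar>fst p\<bar> * \<bar>snd p\<bar>"
      by (simp add: stream_def abs_mult)
    also have "\<dots> \<le> 2 * norm p ^ 6 * norm p * norm p"
      using 1 by (intro mult_mono) auto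
    also have "\<dots> = 2 * (norm p ^ 3 * norm p ^ 5)"
      by (simp add: power_numeral_reduce)
    also have "\<dots> \<le> 2 * (norm p ^ 3 * 1)"
      using n by (intro mult_left_mono power_le_one) auto
    also have "\<dots> \<le> 4 * norm p ^ 3" by simp
    finally show "\<bar>stream p\<bar> \<le> 4 * norm p ^ 3" .
  qed (use stream_has_derivative in \<open>auto simp: zero_prod_def\<close>)
  then show ?thesis
    by (rule has_derivative_eq_rhs) (auto simp: algebra_simps inner_prod_def)
qed

subsection \<open>Functions of class \<open>C\<^sup>k\<close>\<close>

lemma grad_eqI:
  fixes f :: "real^'n \<Rightarrow> real"
  assumes "(f has_derivative (\<lambda>h. v \<bullet> h)) (at x)"
  shows "grad f x = v"
  using frechet_derivative_at[OF assms, symmetric]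
  by (simp add: grad_def vec_eq_iff inner_axis)

lemma has_derivative_grad:
  fixes f :: "real^'n \<Rightarrow> real"
  assumes "f differentiable (at x)"
  shows "(f has_derivative (\<lambda>h. grad f x \<bullet> h)) (at x)"
proof -
  obtain f' where f': "(f has_derivative f') (at x)" using assms by (auto simp: differentiable_def)
  then interpret bounded_linear f' by (rule has_derivative_bounded_linear)
  have "f' h = grad f x \<bullet> h" for h
  proof -
    have "f' h = f' (\<Sum>i\<in>UNIV. (h $ i) *\<^sub>R axis i 1)"
      using basis_expansion[of h] by (simp add: scalar_mult_eq_scaleR)
    also have "\<dots> = (\<Sum>i\<in>UNIV. (h $ i) * f' (axis i 1))" by (simp add: sum scaleR)
    finally show ?thesis
      using frechet_derivative_at[OF f', symmetric]
      by (simp add: grad_def inner_vec_def mult.commute)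
  qed
  then have "f' = (\<lambda>h. grad f x \<bullet> h)" by auto
  then show ?thesis using f' by simp
qed

lemma grad_mult:
  fixes f g :: "real^'n \<Rightarrow> real"
  assumes "f differentiable (at x)" "g differentiable (at x)"
  shows "grad (\<lambda>x. f x * g x) x = f x *\<^sub>R grad g x + g x *\<^sub>R grad f x"
  by (rule grad_eqI, rule has_derivative_eq_rhs,
      rule has_derivative_mult[OF has_derivative_grad[OF assms(1)] has_derivative_grad[OF assms(2)]])
    (auto simp: inner_add_left algebra_simps)

lemma grad_add:
  fixes f g :: "real^'n \<Rightarrow> real"
  assumes "f differentiable (at x)" "g differentiable (at x)"
  shows "grad (\<lambda>x. f x + g x) x = grad f x + grad g x"
  by (rule grad_eqI, rule has_derivative_eq_rhs,
      rule has_derivative_add[OF has_derivative_grad[OF assms(1)] has_derivative_grad[OF assms(2)]])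
    (auto simp: inner_add_left algebra_simps)

lemma grad_diff:
  fixes f g :: "real^'n \<Rightarrow> real"
  assumes "f differentiable (at x)" "g differentiable (at x)"
  shows "grad (\<lambda>x. f x - g x) x = grad f x - grad g x"
  by (rule grad_eqI, rule has_derivative_eq_rhs,
      rule has_derivative_diff[OF has_derivative_grad[OF assms(1)] has_derivative_grad[OF assms(2)]])
    (auto simp: inner_diff_left algebra_simps)

lemma grad_const: "grad (\<lambda>x::real^'n. c) x = 0"
  by (rule grad_eqI) (auto intro!: derivative_eq_intros)

lemma grad_cong_open:
  assumes "open U" "x \<in> U" "\<And>x. x \<in> U \<Longrightarrow> f x = g x"
  shows "grad f x = grad g x"
proof -
  have "(f has_derivative D) (at x) \<longleftrightarrow> (g has_derivative D) (at x)" for D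
    using has_derivative_transform_within_open[of f D x UNIV U g]
      has_derivative_transform_within_open[of g D x UNIV U f] assms by auto
  then have "frechet_derivative f (at x) = frechet_derivative g (at x)"
    unfolding frechet_derivative_def by simp
  then show ?thesis by (simp add: grad_def)
qed

lemma C_k_on_cong:
  assumes "open U" "\<And>x. x \<in> U \<Longrightarrow> f x = g x"
  shows "C_k_on k U f \<longleftrightarrow> C_k_on k U g"
  using assms(2)
proof (induction k arbitrary: f g)
  case 0
  then show ?case by (auto intro!: continuous_on_cong)
next
  case (Suc k)
  have "f differentiable at x \<longleftrightarrow> g differentiable at x" if "x \<in> U" for x
    unfolding differentiable_def
    using has_derivative_transform_within_open[of f _ x UNIV U g]
      has_derivative_transform_within_open[of g _ x UNIV U f] assms(1) that Suc.prems by metis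
  moreover have "C_k_on k U (\<lambda>x. grad f x $ i) \<longleftrightarrow> C_k_on k U (\<lambda>x. grad g x $ i)" for i
    by (rule Suc.IH) (metis grad_cong_open[OF assms(1)] Suc.prems)
  ultimately show ?case by simp
qed

lemma C_k_on_subset: "C_k_on k U f \<Longrightarrow> V \<subseteq> U \<Longrightarrow> C_k_on k V f"
  by (induction k arbitrary: f) (auto intro: continuous_on_subset)

lemma C_k_on_SucD: "C_k_on (Suc k) U f \<Longrightarrow> C_k_on k U f"
proof (induction k arbitrary: f)
  case 0
  then show ?case
    by (auto intro!: continuous_at_imp_continuous_on simp: differentiable_imp_continuous_within)
qed auto

lemma C_k_on_mono: "C_k_on k U f \<Longrightarrow> j \<le> k \<Longrightarrow> C_k_on j U f"
  by (induction k) (auto simp: le_Suc_eq simp del: C_k_on.simps dest: C_k_on_SucD)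

lemma C_k_on_continuous: "C_k_on k U f \<Longrightarrow> continuous_on U f"
  using C_k_on_mono[of k U f 0] by simp

lemma C_k_on_const: "C_k_on k U (\<lambda>x::real^'n. c)"
  by (induction k arbitrary: c) (auto simp: grad_const)

lemma C_k_on_add:
  fixes f g :: "real^'n \<Rightarrow> real"
  assumes "C_k_on k UNIV f" "C_k_on k UNIV g"
  shows "C_k_on k UNIV (\<lambda>x. f x + g x)"
  using assms
proof (induction k arbitrary: f g)
  case 0
  then show ?case by (auto intro: continuous_intros)
next
  case (Suc k)
  have "(\<lambda>x. grad (\<lambda>x. f x + g x) x $ i) = (\<lambda>x. grad f x $ i + grad g x $ i)" for i
    using Suc.prems by (auto simp: grad_add)
  then show ?case using Suc by auto
qed

lemma C_k_on_mult:
  fixes f g :: "real^'n \<Rightarrow> real"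
  assumes "C_k_on k UNIV f" "C_k_on k UNIV g"
  shows "C_k_on k UNIV (\<lambda>x. f x * g x)"
  using assms
proof (induction k arbitrary: f g)
  case 0
  then show ?case by (auto intro: continuous_intros)
next
  case (Suc k)
  have "(\<lambda>x. grad (\<lambda>x. f x * g x) x $ i) = (\<lambda>x. f x * grad g x $ i + g x * grad f x $ i)" for i
    using Suc.prems by (auto simp: grad_mult)
  moreover have "C_k_on k UNIV (\<lambda>x. f x * grad g x $ i + g x * grad f x $ i)" for i
    using Suc.prems by (intro C_k_on_add Suc.IH) (auto intro: C_k_on_SucD)
  ultimately show ?case using Suc.prems by auto
qed

lemma C_k_on_prod:
  fixes f :: "'i \<Rightarrow> real^'n \<Rightarrow> real"
  shows "(\<And>i. C_k_on k UNIV (f i)) \<Longrightarrow> C_k_on k UNIV (\<lambda>x. \<Prod>i\<in>I. f i x)"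
  by (induction I rule: infinite_finite_induct) (auto intro: C_k_on_mult C_k_on_const)

lemma C_1_on_I:
  fixes f :: "real^'n \<Rightarrow> real"
  assumes "\<And>x. (f has_derivative (\<lambda>h. G x \<bullet> h)) (at x)" "\<And>i. continuous_on UNIV (\<lambda>x. G x $ i)"
  shows "C_k_on 1 UNIV f" "grad f = G"
proof -
  show "grad f = G" using grad_eqI[OF assms(1)] by auto
  then show "C_k_on 1 UNIV f" using assms by (auto simp: differentiable_def)
qed

lemma C_1_on_D:
  fixes f :: "real^'n \<Rightarrow> real"
  assumes "C_k_on 1 UNIV f"
  shows "f differentiable (at x)" "continuous_on UNIV f" "continuous_on UNIV (\<lambda>x. grad f x $ i)"
    "continuous_on UNIV (grad f)"
proof -
  show 1: "f differentiable (at x)" "continuous_on UNIV f" "continuous_on UNIV (\<lambda>x. grad f x $ i)" for i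
    using C_k_on_continuous[OF assms] assms by auto
  have "continuous_on UNIV (\<lambda>x. \<chi> i. grad f x $ i)"
    by (rule continuous_on_vec_lambda) (rule 1)
  then show "continuous_on UNIV (grad f)" by simp
qed

subsection \<open>Bump functions\<close>

text \<open>Products of a polynomial in 1/t with exp (- 1/t), extended by zero. The family is closed
  under differentiation, so smoothness needs a single limit at 0 and an induction in which the
  polynomial varies.\<close>

definition flat :: "real poly \<Rightarrow> real \<Rightarrow> real" where
  "flat P t = (if t > 0 then poly P (1/t) * exp (- (1/t)) else 0)"

lemma poly_times_exp_minus_tendsto_0: "((\<lambda>x::real. poly P x * exp (- x)) \<longlongrightarrow> 0) at_top"
proof -
  have "((\<lambda>x. \<Sum>i\<le>degree P. coeff P i * (x ^ i / exp x)) \<longlongrightarrow> (\<Sum>i\<le>degree P. coeff P i * 0)) at_top"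
    by (intro tendsto_intros tendsto_power_div_exp_0)
  then show ?thesis
    by (simp add: poly_altdef exp_minus divide_inverse sum_distrib_right mult.assoc)
qed

lemma flat_tendsto_0: "(flat P \<longlongrightarrow> 0) (at 0)"
  unfolding filterlim_split_at_real[of "flat P"] filterlim_at_split
proof
  show "(flat P \<longlongrightarrow> 0) (at_left 0)"
    by (rule tendsto_eventually) (auto simp: eventually_at_left_field flat_def intro!: exI[of _ "-1"])
  have "((\<lambda>t. poly P (inverse t) * exp (- inverse t)) \<longlongrightarrow> 0) (at_right 0)"
    by (rule filterlim_compose[OF poly_times_exp_minus_tendsto_0 filterlim_inverse_at_top_right])
  then show "(flat P \<longlongrightarrow> 0) (at_right 0)"
    by (rule Lim_transform_eventually)
       (auto simp: eventually_at_right_field flat_def divide_inverse intro!: exI[of _ "1"])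
qed

text \<open>Differentiating P(1/t) exp (- 1/t) gives 1/t^2 times P - P' at 1/t, times the same
  exponential; 1/t^2 is the monomial X^2 evaluated at 1/t.\<close>

definition dflat :: "real poly \<Rightarrow> real poly" where
  "dflat P = [:0, 0, 1:] * (P - pderiv P)"

lemma flat_has_derivative: "(flat P has_real_derivative flat (dflat P) t) (at t)"
proof (cases t "0::real" rule: linorder_cases)
  case less
  have "((\<lambda>_. 0) has_real_derivative flat (dflat P) t) (at t)"
    using less by (auto simp: flat_def)
  then show ?thesis
    by (rule has_field_derivative_transform_within_open[of _ _ _ "{..<0}"]) (use less in \<open>auto simp: flat_def\<close>)
next
  case equal
  \<comment> \<open>Division by h multiplies the polynomial by X, so the difference quotient at 0
    belongs to the family again and tends to 0.\<close>
  have "(\<lambda>h. (flat P (0 + h) - flat P 0) / h) = flat ([:0,1:] * P)"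
    by (auto simp: flat_def)
  then have "(flat P has_real_derivative 0) (at 0)"
    unfolding DERIV_def using flat_tendsto_0[of "[:0,1:] * P"] by simp
  then show ?thesis by (simp add: equal flat_def)
next
  case greater
  have "((\<lambda>t. poly P (1/t) * exp (- (1/t))) has_real_derivative flat (dflat P) t) (at t)"
    using greater
    by (auto intro!: derivative_eq_intros DERIV_chain2[OF poly_DERIV]
             simp: flat_def dflat_def field_simps power2_eq_square)
  then show ?thesis
    by (rule has_field_derivative_transform_within_open[of _ _ _ "{0<..}"]) (use greater in \<open>auto simp: flat_def\<close>)
qed

lemma flat_affine_has_derivative:
  fixes x :: "real^'n"
  shows "((\<lambda>x. flat P (c * x $ i + d)) has_derivative
     (\<lambda>h. axis i (c * flat (dflat P) (c * x $ i + d)) \<bullet> h)) (at x)"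
proof -
  have 1: "((\<lambda>x. c * x $ i + d) has_derivative (\<lambda>h. c * h $ i)) (at x)"
    by (auto intro!: derivative_eq_intros bounded_linear.has_derivative[OF bounded_linear_vec_nth])
  show ?thesis
    using has_derivative_compose[OF 1 flat_has_derivative[unfolded has_field_derivative_def]]
    by (rule has_derivative_eq_rhs) (auto simp: inner_axis' algebra_simps)
qed

lemma C_k_on_flat_affine: "C_k_on k UNIV (\<lambda>x::real^'n. flat P (c * x $ i + d))"
proof (induction k arbitrary: P)
  case 0
  show ?case
    using flat_affine_has_derivative[of P c i d]
    by (auto intro!: continuous_at_imp_continuous_on has_derivative_continuous)
next
  case (Suc k)
  have g: "grad (\<lambda>x. flat P (c * x $ i + d)) = (\<lambda>x. axis i (c * flat (dflat P) (c * x $ i + d)))"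
    by (rule ext, rule grad_eqI, rule flat_affine_has_derivative)
  have "C_k_on k UNIV (\<lambda>x::real^'n. c * flat (dflat P) (c * x $ i + d))"
    by (intro C_k_on_mult C_k_on_const Suc.IH)
  then have "C_k_on k UNIV (\<lambda>x. grad (\<lambda>x. flat P (c * x $ i + d)) x $ j)" for j
    unfolding g by (cases "i = j") (simp_all add: axis_def C_k_on_const)
  then show ?case using flat_affine_has_derivative[of P c i d]
    by (auto simp: differentiable_def)
qed

text \<open>As \<open>k\<close> tends to infinity, \<open>exp (- 1 / (k * t))\<close> tends to the indicator of \<open>t > 0\<close>, so dilation
  replaces mollification.\<close>

definition bump :: "real^'n \<Rightarrow> real^'n \<Rightarrow> real \<Rightarrow> real^'n \<Rightarrow> real" where
  "bump a b k x = (\<Prod>i\<in>UNIV. flat 1 (k * x $ i + - (k * a $ i)) * flat 1 ((- k) * x $ i + k * b $ i))"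

lemma flat_1: "flat 1 t = (if t > 0 then exp (- (1/t)) else 0)"
  by (simp add: flat_def)

lemma bump_range: "0 \<le> bump a b k x" "bump a b k x \<le> 1"
  by (auto simp: bump_def flat_1 intro!: prod_nonneg prod_le_1 mult_le_one)

lemma bump_zero:
  assumes "k > 0" "x \<notin> box a b"
  shows "bump a b k x = 0"
proof -
  obtain i where "\<not> (a $ i < x $ i \<and> x $ i < b $ i)" using assms(2) by (auto simp: mem_box_cart)
  then have "flat 1 (k * x $ i + - (k * a $ i)) * flat 1 ((- k) * x $ i + k * b $ i) = 0"
    using assms(1) by (auto simp: flat_1 mult_less_cancel_left)
  then show ?thesis unfolding bump_def by (intro prod_zero) auto
qed

lemma bump_tendsto_indicator:
  "(\<lambda>n. bump a b (real (Suc n)) x) \<longlonglongrightarrow> indicator (box a b) x"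
proof (cases "x \<in> box a b")
  case False
  then show ?thesis by (simp add: bump_zero)
next
  case True
  have *: "(\<lambda>n. flat 1 (real (Suc n) * c)) \<longlonglongrightarrow> 1" if "c > 0" for c
  proof -
    have "(\<lambda>n. exp (- ((1/c) * inverse (real (Suc n))))) \<longlonglongrightarrow> exp (- ((1/c) * 0))"
      by (intro tendsto_intros LIMSEQ_inverse_real_of_nat)
    moreover have "flat 1 (real (Suc n) * c) = exp (- ((1/c) * inverse (real (Suc n))))" for n
      using that mult_pos_pos[of "real (Suc n)" c]
      by (simp add: flat_1 del: of_nat_Suc) (simp add: field_simps)
    ultimately show ?thesis by simp
  qed
  have "(\<lambda>n. \<Prod>i\<in>UNIV. flat 1 (real (Suc n) * (x $ i - a $ i)) * flat 1 (real (Suc n) * (b $ i - x $ i)))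
     \<longlonglongrightarrow> (\<Prod>i\<in>(UNIV::'a set). 1 * 1)"
    using True by (intro tendsto_intros *) (auto simp: mem_box_cart)
  moreover have "bump a b (real (Suc n)) x =
     (\<Prod>i\<in>UNIV. flat 1 (real (Suc n) * (x $ i - a $ i)) * flat 1 (real (Suc n) * (b $ i - x $ i)))" for n
    unfolding bump_def by (simp add: algebra_simps)
  ultimately show ?thesis using True by simp
qed

lemma test_function_bump:
  assumes "cbox a b \<subseteq> \<Omega>" "k > 0"
  shows "test_function \<Omega> (bump a b k)"
proof -
  have "smooth_on UNIV (bump a b k)"
    unfolding smooth_on_def bump_def
    by (intro allI C_k_on_prod C_k_on_mult C_k_on_flat_affine)
  moreover have "{x. bump a b k x \<noteq> 0} \<subseteq> cbox a b"
    using bump_zero[OF assms(2)] box_subset_cbox by blast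
  then have "closure {x. bump a b k x \<noteq> 0} \<subseteq> cbox a b"
    by (rule closure_minimal[OF _ closed_cbox])
  ultimately show ?thesis
    unfolding test_function_def using assms(1)
    by (meson bounded_cbox bounded_subset closed_closure compact_eq_bounded_closed subset_trans)
qed

subsection \<open>Integration by parts\<close>

lemma borel_measurable_continuous_UNIV:
  fixes f :: "'a::topological_space \<Rightarrow> 'b::topological_space"
  shows "continuous_on UNIV f \<Longrightarrow> f \<in> borel_measurable borel"
  by (rule borel_measurable_continuous_onI)

lemma integral_lebesgue_on_support:
  fixes h :: "'a::euclidean_space \<Rightarrow> real"
  assumes "S \<in> sets lebesgue" "h \<in> borel_measurable borel" "\<And>x. x \<notin> S \<Longrightarrow> h x = 0"
  shows "(LINT x|lebesgue_on S. h x) = (LINT x|lborel. h x)"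
proof -
  have "(LINT x|lebesgue_on S. h x) = (LINT x|lebesgue. indicator S x *\<^sub>R h x)"
    using assms(1) by (intro integral_restrict_space) auto
  also have "\<dots> = (LINT x|lebesgue. h x)"
    using assms(3) by (intro Bochner_Integration.integral_cong) (auto simp: indicator_def)
  also have "\<dots> = (LINT x|lborel. h x)" using assms(2) by (intro integral_completion) auto
  finally show ?thesis .
qed

lemma integrable_continuous_support:
  fixes h :: "'a::euclidean_space \<Rightarrow> real"
  assumes "continuous_on UNIV h" "compact S" "\<And>x. x \<notin> S \<Longrightarrow> h x = 0"
  shows "integrable lborel h"
proof -
  have "integrable lborel (\<lambda>x. indicator S x *\<^sub>R h x)"
    using assms by (intro borel_integrable_compact) (auto intro: continuous_on_subset)
  moreover have "indicator S x *\<^sub>R h x = h x" for x using assms(3)[of x] by (cases "x \<in> S") auto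
  ultimately show ?thesis by (simp only:)
qed

lemma lborel_integral_translation:
  fixes h :: "'a::euclidean_space \<Rightarrow> real"
  assumes "h \<in> borel_measurable borel"
  shows "(LINT x|lborel. h (x + c)) = (LINT x|lborel. h x)"
proof -
  have "(LINT x|lborel. h x) = (LINT x|distr lborel borel ((+) c). h x)"
    by (simp add: lborel_distr_plus)
  also have "\<dots> = (LINT x|lborel. h (c + x))" using assms by (intro integral_distr) auto
  finally show ?thesis by (simp add: add.commute)
qed

text \<open>One compact set catches all translates of \<open>S\<close> by vectors of norm at most 1,
  which gives a single dominating function for a whole sequence of difference quotients.\<close>

lemma compact_thickening:
  fixes S :: "'a::euclidean_space set"
  assumes "compact S"
  obtains C where "compact C" "\<And>x h. x \<in> S \<Longrightarrow> norm h \<le> 1 \<Longrightarrow> x + h \<in> C"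
proof
  show "compact {x + y |x y. x \<in> S \<and> y \<in> cball 0 1}"
    by (rule compact_sums[OF assms]) auto
qed auto

lemma has_real_derivative_along_axis:
  fixes f :: "real^'n \<Rightarrow> real"
  assumes "C_k_on 1 UNIV f"
  shows "((\<lambda>t. f (x + t *\<^sub>R axis i 1)) has_real_derivative grad f (x + t *\<^sub>R axis i 1) $ i) (at t)"
proof -
  have 1: "((\<lambda>t. x + t *\<^sub>R axis i 1) has_derivative (\<lambda>t. t *\<^sub>R axis i 1)) (at t)"
    by (auto intro!: derivative_eq_intros)
  show ?thesis
    unfolding has_field_derivative_def
    using has_derivative_compose[OF 1 has_derivative_grad[OF C_1_on_D(1)[OF assms]]]
    by (rule has_derivative_eq_rhs) (auto simp: inner_axis)
qed

text \<open>Dominated convergence without compact supports: the indicator provides integrability,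
  and the mean value theorem on a thickening of \<open>C\<close> bounds all quotients by the same
  constant.\<close>

lemma difference_quotient_integral_tendsto:
  fixes f g :: "real^'n \<Rightarrow> real"
  assumes f: "C_k_on 1 UNIV f" and g: "continuous_on UNIV g" and C: "compact C"
    and s: "s \<longlonglongrightarrow> 0" "\<And>n. s n \<noteq> 0" "\<And>n. \<bar>s n\<bar> \<le> 1"
  shows "(\<lambda>n. LINT x|lborel. indicator C x *\<^sub>R ((f (x + s n *\<^sub>R axis i 1) - f x) / s n * g x))
    \<longlonglongrightarrow> (LINT x|lborel. indicator C x *\<^sub>R (grad f x $ i * g x))"
proof -
  obtain C' where C': "compact C'" "\<And>x h. x \<in> C \<Longrightarrow> norm h \<le> 1 \<Longrightarrow> x + h \<in> C'"
    using compact_thickening[OF C] by blast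
  have "compact ((\<lambda>x. grad f x $ i) ` C')"
    using C_1_on_D(3)[OF f] C'(1) by (meson compact_continuous_image continuous_on_subset subset_UNIV)
  then obtain M where M: "\<And>x. x \<in> C' \<Longrightarrow> \<bar>grad f x $ i\<bar> \<le> M"
    by (fastforce dest!: compact_imp_bounded simp: bounded_iff)
  have mvt: "\<bar>(f (x + s n *\<^sub>R axis i 1) - f x) / s n\<bar> \<le> M" if "x \<in> C" for x n
  proof -
    have "norm (f (x + s n *\<^sub>R axis i 1) - f (x + 0 *\<^sub>R axis i 1)) \<le> M * norm (s n - 0)"
    proof (rule field_differentiable_bound[of "{-1..1}" "\<lambda>t. f (x + t *\<^sub>R axis i 1)" "\<lambda>t. grad f (x + t *\<^sub>R axis i 1) $ i"])
      fix t :: real assume "t \<in> {-1..1}"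
      then show "norm (grad f (x + t *\<^sub>R axis i 1) $ i) \<le> M"
        using that by (auto intro!: M C'(2))
      show "((\<lambda>t. f (x + t *\<^sub>R axis i 1)) has_real_derivative grad f (x + t *\<^sub>R axis i 1) $ i) (at t within {-1..1})"
        by (rule has_field_derivative_at_within[OF has_real_derivative_along_axis[OF f]])
    qed (use s(3)[of n] in auto)
    then show ?thesis using s(2)[of n] by (simp add: abs_divide divide_le_eq)
  qed
  have [measurable]: "C \<in> sets borel" using C by (simp add: borel_compact)
  have [measurable]: "f \<in> borel_measurable borel" "g \<in> borel_measurable borel"
     "(\<lambda>x. grad f x $ i) \<in> borel_measurable borel"
    using C_1_on_D[OF f] g by (auto intro!: borel_measurable_continuous_UNIV)
  have [measurable]: "(\<lambda>x. f (x + c)) \<in> borel_measurable borel" for c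
  proof -
    have "(\<lambda>x::real^'n. x + c) \<in> borel_measurable borel"
      by (intro borel_measurable_continuous_UNIV continuous_intros)
    then show ?thesis by measurable
  qed
  show ?thesis
  proof (rule integral_dominated_convergence)
    show "integrable lborel (\<lambda>x. indicator C x *\<^sub>R (M * \<bar>g x\<bar>))"
      using C g by (intro borel_integrable_compact continuous_intros) (auto intro: continuous_on_subset)
    show "AE x in lborel. (\<lambda>n. indicator C x *\<^sub>R ((f (x + s n *\<^sub>R axis i 1) - f x) / s n * g x))
      \<longlonglongrightarrow> indicator C x *\<^sub>R (grad f x $ i * g x)"
    proof (rule AE_I2, intro tendsto_intros)
      fix x
      have "filterlim s (at 0) sequentially"
        using s by (intro filterlim_atI) auto
      then have "(\<lambda>n. (f (x + (0 + s n) *\<^sub>R axis i 1) - f (x + 0 *\<^sub>R axis i 1)) / s n) \<longlonglongrightarrow> grad f (x + 0 *\<^sub>R axis i 1) $ i"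
        using has_real_derivative_along_axis[OF f, of x i 0] unfolding DERIV_def
        by (rule filterlim_compose[rotated])
      then show "(\<lambda>n. (f (x + s n *\<^sub>R axis i 1) - f x) / s n) \<longlonglongrightarrow> grad f x $ i" by simp
    qed
    show "AE x in lborel. norm (indicator C x *\<^sub>R ((f (x + s n *\<^sub>R axis i 1) - f x) / s n * g x))
      \<le> indicator C x *\<^sub>R (M * \<bar>g x\<bar>)" for n
    proof (rule AE_I2)
      fix x
      show "norm (indicator C x *\<^sub>R ((f (x + s n *\<^sub>R axis i 1) - f x) / s n * g x)) \<le> indicator C x *\<^sub>R (M * \<bar>g x\<bar>)"
        using mult_right_mono[OF mvt[of x n], of "\<bar>g x\<bar>"]
        by (cases "x \<in> C") (auto simp: abs_mult)
    qed
  qed measurable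
qed

lemma grad_zero_outside:
  fixes f :: "real^'n \<Rightarrow> real"
  assumes "compact S" "\<And>x. x \<notin> S \<Longrightarrow> f x = 0" "x \<notin> S"
  shows "grad f x = 0"
proof -
  have "grad f x = grad (\<lambda>_. 0) x"
    by (rule grad_cong_open[of "- S"]) (use assms in \<open>auto simp: compact_imp_closed\<close>)
  then show ?thesis by (simp add: grad_const)
qed

text \<open>By translation invariance the integral of every difference quotient is exactly zero, and
  this survives the limit.\<close>

lemma integral_grad_eq_0:
  fixes f :: "real^'n \<Rightarrow> real"
  assumes f: "C_k_on 1 UNIV f" and S: "compact S" "\<And>x. x \<notin> S \<Longrightarrow> f x = 0"
  shows "(LINT x|lborel. grad f x $ i) = 0"
proof -
  obtain C where C: "compact C" "\<And>x h. x \<in> S \<Longrightarrow> norm h \<le> 1 \<Longrightarrow> x + h \<in> C"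
    using compact_thickening[OF S(1)] by blast
  define s where "s = (\<lambda>n. inverse (real (Suc n)))"
  have s: "s \<longlonglongrightarrow> 0" "\<And>n. s n \<noteq> 0" "\<And>n. \<bar>s n\<bar> \<le> 1"
    using LIMSEQ_inverse_real_of_nat by (auto simp: s_def field_simps)
  have SC: "S \<subseteq> C" using C(2)[of _ 0] by auto
  have cf: "continuous_on UNIV f" by (rule C_1_on_D[OF f])
  have eq0: "(LINT x|lborel. indicator C x *\<^sub>R ((f (x + s n *\<^sub>R axis i 1) - f x) / s n * 1)) = 0" for n
  proof -
    let ?c = "s n *\<^sub>R axis i 1 :: real^'n"
    have z: "x \<in> C" if "x + ?c \<in> S" for x
      using C(2)[OF that, of "- ?c"] s(3)[of n] by simp
    have eq: "indicator C x *\<^sub>R ((f (x + ?c) - f x) / s n * 1) = (f (x + ?c) - f x) / s n" for x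
    proof (cases "x \<in> C")
      case False
      then have "f x = 0" "f (x + ?c) = 0" using SC z S(2) by blast+
      then show ?thesis by simp
    qed simp
    moreover have "integrable lborel f" "integrable lborel (\<lambda>x. f (x + ?c))"
      using S SC z by (auto intro!: integrable_continuous_support[OF _ C(1)] continuous_intros
          continuous_on_compose2[OF cf] cf)
    moreover have "(LINT x|lborel. f (x + ?c)) = (LINT x|lborel. f x)"
      by (intro lborel_integral_translation borel_measurable_continuous_UNIV cf)
    ultimately show ?thesis unfolding eq by simp
  qed
  have "(\<lambda>n. 0) \<longlonglongrightarrow> (LINT x|lborel. indicator C x *\<^sub>R (grad f x $ i * 1))"
    using difference_quotient_integral_tendsto[OF f continuous_on_const[of UNIV 1] C(1) s, where i = i] unfolding eq0 .
  moreover have "indicator C x *\<^sub>R (grad f x $ i * 1) = grad f x $ i" for x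
  proof (cases "x \<in> C")
    case False
    then have "grad f x = 0" using SC grad_zero_outside[of S f x, OF S] by blast
    then show ?thesis by simp
  qed simp
  ultimately show ?thesis by (simp only: LIMSEQ_const_iff)
qed

lemma integral_by_parts:
  fixes f g :: "real^'n \<Rightarrow> real"
  assumes f: "C_k_on 1 UNIV f" and g: "C_k_on 1 UNIV g"
    and S: "compact S" "\<And>x. x \<notin> S \<Longrightarrow> g x = 0"
  shows "(LINT x|lborel. f x * grad g x $ i) = - (LINT x|lborel. grad f x $ i * g x)"
proof -
  note D = C_1_on_D[OF f] C_1_on_D[OF g]
  have "(LINT x|lborel. grad (\<lambda>x. f x * g x) x $ i) = 0"
    using S(2) by (intro integral_grad_eq_0[OF C_k_on_mult[OF f g] S(1)]) auto
  moreover have "grad (\<lambda>x. f x * g x) x $ i = f x * grad g x $ i + grad f x $ i * g x" for x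
    using grad_mult[OF D(1,5), of x] by (simp add: algebra_simps)
  moreover have "integrable lborel (\<lambda>x. f x * grad g x $ i)" "integrable lborel (\<lambda>x. grad f x $ i * g x)"
    using S(2) grad_zero_outside[OF S]
    by (auto intro!: integrable_continuous_support[OF _ S(1)] continuous_intros D)
  ultimately show ?thesis by simp
qed

lemma C_1_on_shift:
  fixes f :: "real^'n \<Rightarrow> real"
  assumes "C_k_on 1 UNIV f"
  shows "C_k_on 1 UNIV (\<lambda>x. f (x + c))" "grad (\<lambda>x. f (x + c)) = (\<lambda>x. grad f (x + c))"
proof -
  have 1: "((\<lambda>x. f (x + c)) has_derivative (\<lambda>h. grad f (x + c) \<bullet> h)) (at x)" for x
    by (rule has_derivative_compose[OF _ has_derivative_grad[OF C_1_on_D(1)[OF assms]]])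
       (auto intro!: derivative_eq_intros)
  have 2: "continuous_on UNIV (\<lambda>x. grad f (x + c) $ i)" for i
    by (rule continuous_on_compose2[OF C_1_on_D(3)[OF assms]]) (auto intro!: continuous_intros)
  show "C_k_on 1 UNIV (\<lambda>x. f (x + c))" "grad (\<lambda>x. f (x + c)) = (\<lambda>x. grad f (x + c))"
    using C_1_on_I[OF 1 2] by auto
qed

text \<open>Both functions are only \<open>C\<^sup>1\<close>: a difference quotient in direction \<open>i\<close> is moved across the integral
  in place of the mixed second derivatives.\<close>

lemma integral_grad_skew:
  fixes f g :: "real^'n \<Rightarrow> real"
  assumes f: "C_k_on 1 UNIV f" and g: "C_k_on 1 UNIV g"
    and S: "compact S" "\<And>x. x \<notin> S \<Longrightarrow> g x = 0"
  shows "(LINT x|lborel. grad f x $ j * grad g x $ i) = (LINT x|lborel. grad f x $ i * grad g x $ j)"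
proof -
  note Df = C_1_on_D[OF f] and Dg = C_1_on_D[OF g]
  obtain C where C: "compact C" "\<And>x h. x \<in> S \<Longrightarrow> norm h \<le> 1 \<Longrightarrow> x + h \<in> C"
    using compact_thickening[OF S(1)] by blast
  define s where "s = (\<lambda>n. inverse (real (Suc n)))"
  have s: "s \<longlonglongrightarrow> 0" "\<And>n. s n \<noteq> 0" "\<And>n. \<bar>s n\<bar> \<le> 1"
    using LIMSEQ_inverse_real_of_nat by (auto simp: s_def field_simps)
  \<comment> \<open>Moving a translation onto the other factor reverses it, so the quotients of
    \<open>f\<close> appear with negative steps.\<close>
  have ms: "(\<lambda>n. - s n) \<longlonglongrightarrow> 0" "\<And>n. - s n \<noteq> 0" "\<And>n. \<bar>- s n\<bar> \<le> 1"
    using s tendsto_minus[OF s(1)] by auto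
  have SC: "S \<subseteq> C" using C(2)[of _ 0] by auto
  have gz: "grad g x = 0" if "x \<notin> S" for x using grad_zero_outside[OF S that] .
  let ?e = "axis i 1 :: real^'n"
  have eq: "(LINT x|lborel. indicator C x *\<^sub>R ((g (x + s n *\<^sub>R ?e) - g x) / s n * grad f x $ j))
    = (LINT x|lborel. indicator C x *\<^sub>R ((f (x + - s n *\<^sub>R ?e) - f x) / - s n * grad g x $ j))" for n
  proof -
    let ?c = "s n *\<^sub>R ?e"
    have z: "x \<in> C" if "x + ?c \<in> S" for x
      using C(2)[OF that, of "- ?c"] s(3)[of n] by simp
    have gC: "grad g x = 0" "grad g (x + ?c) = 0" if "x \<notin> C" for x
      using that SC z gz by blast+
    \<comment> \<open>The difference quotient of \<open>g\<close> is again C^1 with compact support,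
      so integration by parts in direction \<open>j\<close> applies to it although
      \<open>grad g\<close> need not be differentiable.\<close>
    define q where "q = (\<lambda>x. inverse (s n) * (g (x + ?c) + (- 1) * g x))"
    have q: "C_k_on 1 UNIV q"
      unfolding q_def by (intro C_k_on_mult C_k_on_add C_k_on_const C_1_on_shift g)
    have gq: "grad q x = inverse (s n) *\<^sub>R (grad g (x + ?c) - grad g x)" for x
      unfolding q_def using Dg(1)[of x] C_1_on_D(1)[OF C_1_on_shift(1)[OF g], of ?c x]
      by (simp add: grad_mult grad_diff grad_const C_1_on_shift(2)[OF g])
    have qz: "q x = 0" if "x \<notin> C" for x
    proof -
      have "g x = 0" "g (x + ?c) = 0" using that SC z S(2) by blast+
      then show ?thesis by (simp add: q_def)
    qed
    have "indicator C x *\<^sub>R ((g (x + ?c) - g x) / s n * grad f x $ j) = grad f x $ j * q x" for x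
      using qz[of x] by (cases "x \<in> C") (auto simp: q_def divide_inverse)
    then have "(LINT x|lborel. indicator C x *\<^sub>R ((g (x + ?c) - g x) / s n * grad f x $ j))
       = (LINT x|lborel. grad f x $ j * q x)" by simp
    also have "\<dots> = - (LINT x|lborel. f x * grad q x $ j)"
      using integral_by_parts[OF f q C(1) qz, of j] by simp
    also have "(LINT x|lborel. f x * grad q x $ j)
        = inverse (s n) * ((LINT x|lborel. f x * grad g (x + ?c) $ j) - (LINT x|lborel. f x * grad g x $ j))"
    proof -
      have "integrable lborel (\<lambda>x. f x * grad g x $ j)" "integrable lborel (\<lambda>x. f x * grad g (x + ?c) $ j)"
        using gC by (auto intro!: integrable_continuous_support[OF _ C(1)] continuous_intros Df(2) Dg(3)
            continuous_on_compose2[OF Dg(4)])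
      moreover have "f x * grad q x $ j = inverse (s n) * (f x * grad g (x + ?c) $ j - f x * grad g x $ j)" for x
        by (simp add: gq algebra_simps)
      ultimately show ?thesis
        by (simp only: Bochner_Integration.integral_diff integral_mult_right_zero)
    qed
    \<comment> \<open>Translation moves the shift from \<open>grad g\<close> to \<open>f\<close>: a
      discrete integration by parts in direction \<open>i\<close>.\<close>
    also have "(LINT x|lborel. f x * grad g (x + ?c) $ j) = (LINT x|lborel. f (x - ?c) * grad g x $ j)"
    proof -
      have "continuous_on UNIV (\<lambda>x. f (x - ?c) * grad g x $ j)"
        by (auto intro!: continuous_intros Dg continuous_on_compose2[OF Df(2)])
      from lborel_integral_translation[OF borel_measurable_continuous_UNIV[OF this], of ?c]
      show ?thesis by simp
    qed
    also have "- (inverse (s n) * ((LINT x|lborel. f (x - ?c) * grad g x $ j) - (LINT x|lborel. f x * grad g x $ j)))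
       = (LINT x|lborel. (f (x - ?c) - f x) / - s n * grad g x $ j)"
    proof -
      have "integrable lborel (\<lambda>x. f x * grad g x $ j)" "integrable lborel (\<lambda>x. f (x - ?c) * grad g x $ j)"
        using gC by (auto intro!: integrable_continuous_support[OF _ C(1)] continuous_intros Df(2) Dg(3)
            continuous_on_compose2[OF Df(2)])
      then have "(LINT x|lborel. (- inverse (s n)) * (f (x - ?c) * grad g x $ j - f x * grad g x $ j))
         = - (inverse (s n) * ((LINT x|lborel. f (x - ?c) * grad g x $ j) - (LINT x|lborel. f x * grad g x $ j)))"
        by simp
      then show ?thesis by (simp add: divide_inverse algebra_simps)
    qed
    also have "\<dots> = (LINT x|lborel. indicator C x *\<^sub>R ((f (x + - s n *\<^sub>R ?e) - f x) / - s n * grad g x $ j))"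
    proof (intro Bochner_Integration.integral_cong refl)
      fix x
      show "(f (x - ?c) - f x) / - s n * grad g x $ j
        = indicator C x *\<^sub>R ((f (x + - s n *\<^sub>R ?e) - f x) / - s n * grad g x $ j)"
        using gC(1)[of x] by (cases "x \<in> C") auto
    qed
    finally show ?thesis .
  qed
  have "(\<lambda>n. LINT x|lborel. indicator C x *\<^sub>R ((g (x + s n *\<^sub>R ?e) - g x) / s n * grad f x $ j))
     \<longlonglongrightarrow> (LINT x|lborel. indicator C x *\<^sub>R (grad g x $ i * grad f x $ j))"
    by (rule difference_quotient_integral_tendsto[OF g Df(3) C(1) s])
  moreover have "(\<lambda>n. LINT x|lborel. indicator C x *\<^sub>R ((f (x + - s n *\<^sub>R ?e) - f x) / - s n * grad g x $ j))
     \<longlonglongrightarrow> (LINT x|lborel. indicator C x *\<^sub>R (grad f x $ i * grad g x $ j))"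
    by (rule difference_quotient_integral_tendsto[OF f Dg(3) C(1) ms])
  ultimately have "(LINT x|lborel. indicator C x *\<^sub>R (grad g x $ i * grad f x $ j)) =
      (LINT x|lborel. indicator C x *\<^sub>R (grad f x $ i * grad g x $ j))"
    unfolding eq by (rule LIMSEQ_unique)
  moreover have "indicator C x *\<^sub>R (grad g x $ i * grad f x $ j) = grad f x $ j * grad g x $ i"
     "indicator C x *\<^sub>R (grad f x $ i * grad g x $ j) = grad f x $ i * grad g x $ j" for x
    using gz[of x] SC by (cases "x \<in> C"; force)+
  ultimately show ?thesis by (simp only:)
qed

subsection \<open>Weak gradients\<close>

lemma Lp_loc_1_integrable:
  assumes "Lp_loc 1 \<Omega> g" "compact K" "K \<subseteq> \<Omega>"
  shows "integrable (lebesgue_on K) g"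
proof -
  have "g \<in> borel_measurable (lebesgue_on K)" "integrable (lebesgue_on K) (\<lambda>x. norm (g x) powr 1)"
    using assms by (auto simp: Lp_loc_def Lp_on_def)
  then show ?thesis by (simp add: integrable_norm_iff)
qed

lemma compact_sets_lebesgue: "compact K \<Longrightarrow> K \<in> sets lebesgue"
  by (drule borel_compact) simp

lemma integrable_times_compact_support:
  fixes g \<phi> :: "'a::euclidean_space \<Rightarrow> real"
  assumes g: "integrable (lebesgue_on K) g" and K: "compact K" "K \<subseteq> \<Omega>" and \<Omega>: "\<Omega> \<in> sets lebesgue"
    and \<phi>: "continuous_on UNIV \<phi>" "\<And>x. x \<notin> K \<Longrightarrow> \<phi> x = 0"
  shows "integrable (lebesgue_on \<Omega>) (\<lambda>x. g x * \<phi> x)"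
    "(LINT x|lebesgue_on \<Omega>. g x * \<phi> x) = (LINT x|lebesgue. indicator K x *\<^sub>R g x * \<phi> x)"
proof -
  have Kl: "K \<in> sets lebesgue" using K(1) by (rule compact_sets_lebesgue)
  have 1: "integrable lebesgue (\<lambda>x. indicator K x *\<^sub>R g x)"
    using g Kl by (subst (asm) integrable_restrict_space) auto
  have "compact (\<phi> ` K)"
    using \<phi>(1) K(1) by (meson compact_continuous_image continuous_on_subset subset_UNIV)
  then obtain M where "\<forall>x\<in>K. \<bar>\<phi> x\<bar> \<le> M"
    by (fastforce dest!: compact_imp_bounded simp: bounded_iff)
  then have M: "\<bar>\<phi> x\<bar> \<le> max M 0" for x using \<phi>(2)[of x] by (cases "x \<in> K") auto
  have m: "\<phi> \<in> borel_measurable lebesgue"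
    using borel_measurable_continuous_UNIV[OF \<phi>(1)] by (intro measurable_completion) auto
  have 2: "integrable lebesgue (\<lambda>x. indicator K x *\<^sub>R g x * \<phi> x)"
  proof (rule Bochner_Integration.integrable_bound)
    show "integrable lebesgue (\<lambda>x. max M 0 *\<^sub>R (indicator K x *\<^sub>R g x))"
      using 1 by (rule integrable_scaleR_right)
    show "(\<lambda>x. indicator K x *\<^sub>R g x * \<phi> x) \<in> borel_measurable lebesgue"
      using borel_measurable_integrable[OF 1] m by (rule borel_measurable_times)
    show "AE x in lebesgue. norm (indicator K x *\<^sub>R g x * \<phi> x) \<le> norm (max M 0 *\<^sub>R (indicator K x *\<^sub>R g x))"
      using M by (intro AE_I2) (simp add: abs_mult indicator_def mult.commute[of _ "\<bar>\<phi> _\<bar>"] mult_right_mono)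
  qed
  have eq: "indicator \<Omega> x *\<^sub>R (g x * \<phi> x) = indicator K x *\<^sub>R g x * \<phi> x" for x
    using K(2) \<phi>(2)[of x] by (cases "x \<in> K") auto
  show "integrable (lebesgue_on \<Omega>) (\<lambda>x. g x * \<phi> x)"
    using 2 \<Omega> by (subst integrable_restrict_space) (simp_all only: eq space_completion space_lborel space_borel Int_UNIV_right)
  show "(LINT x|lebesgue_on \<Omega>. g x * \<phi> x) = (LINT x|lebesgue. indicator K x *\<^sub>R g x * \<phi> x)"
    using \<Omega> by (subst integral_restrict_space) (simp_all only: eq space_completion space_lborel space_borel Int_UNIV_right)
qed

lemma test_function_support:
  assumes "test_function \<Omega> \<phi>"
  obtains K where "compact K" "K \<subseteq> \<Omega>" "\<And>x. x \<notin> K \<Longrightarrow> \<phi> x = 0"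
  using assms closure_subset[of "{x. \<phi> x \<noteq> 0}"] unfolding test_function_def by blast

lemma test_function_C_1: "test_function \<Omega> \<phi> \<Longrightarrow> C_k_on 1 UNIV \<phi>"
  by (auto simp only: test_function_def smooth_on_def)

section \<open>The fundamental lemma of the calculus of variations\<close>

lemma box_subset_imp_cbox_subset:
  fixes a b c d :: "'a::euclidean_space"
  assumes "box a b \<noteq> {}" "box a b \<subseteq> box c d"
  shows "cbox a b \<subseteq> cbox c d"
proof -
  have "box c d \<noteq> {}" using assms by auto
  then show ?thesis using closure_mono[OF assms(2)] assms(1) by simp
qed

lemma sigma_finite_lebesgue: "sigma_finite_measure (lebesgue :: 'a::euclidean_space measure)"
proof
  obtain A :: "'a set set" where "countable A" "A \<subseteq> sets lborel" "\<Union>A = space lborel"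
      "\<forall>a\<in>A. emeasure lborel a \<noteq> \<infinity>"
    using lborel.sigma_finite_countable by blast
  then show "\<exists>A. countable A \<and> A \<subseteq> sets lebesgue \<and> \<Union> A = space (lebesgue :: 'a measure)
      \<and> (\<forall>a\<in>A. emeasure lebesgue a \<noteq> \<infinity>)"
    by (intro exI[of _ A]) (auto simp: subset_eq emeasure_completion)
qed

text \<open>A pi-lambda argument over the intersection-stable family of boxes. The whole space is
  not a box, yet complements need its integral, hence the separate assumption. A Lebesgue set
  differs from a Borel set by a null set only.\<close>

lemma integral_zero_on_boxes_imp_zero:
  fixes h :: "'a::euclidean_space \<Rightarrow> real"
  assumes h: "integrable lebesgue h"
    and box: "\<And>a b. (LINT x:box a b|lebesgue. h x) = 0" and UNIV: "(LINT x|lebesgue. h x) = 0"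
  shows "AE x in lebesgue. h x = 0"
proof (rule sigma_finite_measure.density_zero[OF sigma_finite_lebesgue h])
  have si: "set_integrable lebesgue A h" if "A \<in> sets lebesgue" for A
    unfolding set_integrable_def by (rule integrable_mult_indicator[OF that h])
  have borel: "(LINT x:A|lebesgue. h x) = 0" if "A \<in> sets borel" for A
  proof -
    let ?G = "range (\<lambda>(a, b). box a b :: 'a set)"
    have sb: "sigma_sets UNIV ?G = sets borel"
      unfolding borel_eq_box by (rule sets_measure_of[symmetric]) auto
    have "Int_stable ?G" "?G \<subseteq> Pow UNIV" by (auto simp: Int_stable_def box_Int_box)
    moreover have "A \<in> sigma_sets UNIV ?G" using that sb by simp
    ultimately show ?thesis
    proof (induction rule: sigma_sets_induct_disjoint)
      case (basic A)
      then show ?case using box by auto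
    next
      case empty
      then show ?case by (simp add: set_lebesgue_integral_def)
    next
      case (compl A)
      then have A: "A \<in> sets lebesgue" using sb by auto
      have "(LINT x:A \<union> (UNIV - A)|lebesgue. h x) = (LINT x:A|lebesgue. h x) + (LINT x:UNIV - A|lebesgue. h x)"
        using A by (intro set_integral_Un si) auto
      then show ?case using compl UNIV by (simp add: set_lebesgue_integral_def)
    next
      case (union A)
      then have A: "A i \<in> sets lebesgue" for i using sb by (auto simp: subset_eq)
      have "(LINT x:(\<Union>i. A i)|lebesgue. h x) = (\<Sum>i. (LINT x:(A i)|lebesgue. h x))"
        using union(1) A by (intro lebesgue_integral_countable_add si sets.countable_UN)
          (auto simp: disjoint_family_on_def)
      then show ?case using union by simp
    qed
  qed
  fix A :: "'a set" assume "A \<in> sets lebesgue"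
  then obtain S N N' where A: "A = S \<union> N" "N \<subseteq> N'" "N' \<in> null_sets lborel" "S \<in> sets lborel"
    by (rule sets_completionE)
  have "(LINT x:A|lebesgue. h x) = (LINT x:S|lebesgue. h x)"
    unfolding set_lebesgue_integral_def
  proof (rule integral_cong_AE)
    have "AE x in lborel. x \<notin> N'" using A(3) by (rule AE_not_in)
    then have "AE x in lebesgue. x \<notin> N'" by (rule AE_completion)
    then show "AE x in lebesgue. indicat_real A x *\<^sub>R h x = indicat_real S x *\<^sub>R h x"
      by eventually_elim (use A in \<open>auto simp: indicator_def\<close>)
  qed (use si[OF \<open>A \<in> sets lebesgue\<close>] si[of S] A in \<open>auto simp: set_integrable_def intro: borel_measurable_integrable\<close>)
  then show "(LINT x:A|lebesgue. h x) = 0" using borel A(4) by simp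
qed

text \<open>The bumps converge boundedly to the indicator of a box, so \<open>g\<close> has integral
  zero over every box whose closed version lies in \<open>\<Omega>\<close>. Countably many closed
  boxes exhaust \<open>\<Omega>\<close>, so it suffices to conclude on each of them.\<close>

lemma fundamental_lemma:
  fixes g :: "real^'n \<Rightarrow> real"
  assumes \<Omega>: "open \<Omega>" and g: "\<And>K. compact K \<Longrightarrow> K \<subseteq> \<Omega> \<Longrightarrow> integrable (lebesgue_on K) g"
    and zero: "\<And>\<phi>. test_function \<Omega> \<phi> \<Longrightarrow> (LINT x|lebesgue_on \<Omega>. g x * \<phi> x) = 0"
  shows "AE x in lebesgue_on \<Omega>. g x = 0"
proof -
  have gi: "integrable lebesgue (\<lambda>x. indicator (cbox a b) x *\<^sub>R g x)" if "cbox a b \<subseteq> \<Omega>" for a b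
    using g[OF compact_cbox that] by (subst (asm) integrable_restrict_space) auto
  have box0: "(LINT x|lebesgue. indicator (box a b) x * g x) = 0" if ab: "cbox a b \<subseteq> \<Omega>" for a b
  proof -
    have "(\<lambda>n. LINT x|lebesgue. indicator (cbox a b) x *\<^sub>R g x * bump a b (real (Suc n)) x)
       \<longlonglongrightarrow> (LINT x|lebesgue. indicator (cbox a b) x *\<^sub>R g x * indicator (box a b) x)"
    proof (rule integral_dominated_convergence)
      have m: "bump a b k \<in> borel_measurable lebesgue" if "k > 0" for k
        using C_1_on_D(2)[OF test_function_C_1[OF test_function_bump[OF ab that]]]
        by (intro measurable_completion) (auto intro: borel_measurable_continuous_UNIV)
      show "(\<lambda>x. indicator (cbox a b) x *\<^sub>R g x * bump a b (real (Suc n)) x) \<in> borel_measurable lebesgue" for n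
        by (intro borel_measurable_times borel_measurable_integrable[OF gi[OF ab]] m) simp
      show "(\<lambda>x. indicator (cbox a b) x *\<^sub>R g x * indicator (box a b) x) \<in> borel_measurable lebesgue"
        by (intro borel_measurable_times borel_measurable_integrable[OF gi[OF ab]] borel_measurable_indicator) auto
      show "integrable lebesgue (\<lambda>x. \<bar>indicator (cbox a b) x *\<^sub>R g x\<bar>)"
        by (rule integrable_abs[OF gi[OF ab]])
      show "AE x in lebesgue. (\<lambda>n. indicator (cbox a b) x *\<^sub>R g x * bump a b (real (Suc n)) x)
          \<longlonglongrightarrow> indicator (cbox a b) x *\<^sub>R g x * indicator (box a b) x"
        by (intro AE_I2 tendsto_intros bump_tendsto_indicator)
      show "AE x in lebesgue. norm (indicator (cbox a b) x *\<^sub>R g x * bump a b (real (Suc n)) x)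
          \<le> \<bar>indicator (cbox a b) x *\<^sub>R g x\<bar>" for n
        using bump_range[of a b "real (Suc n)"] mult_left_mono[OF bump_range(2)[of a b "real (Suc n)"]]
        by (intro AE_I2) (auto simp: abs_mult indicator_def simp del: of_nat_Suc)
    qed
    moreover have "(LINT x|lebesgue. indicator (cbox a b) x *\<^sub>R g x * bump a b (real (Suc n)) x) = 0" for n
    proof -
      have t: "test_function \<Omega> (bump a b (real (Suc n)))" by (rule test_function_bump[OF ab]) simp
      have "\<And>x. x \<notin> cbox a b \<Longrightarrow> bump a b (real (Suc n)) x = 0"
        using bump_zero[of "real (Suc n)"] box_subset_cbox[of a b] by auto
      then show ?thesis
        using integrable_times_compact_support(2)[OF g[OF compact_cbox ab] compact_cbox ab _
            C_1_on_D(2)[OF test_function_C_1[OF t]]] zero[OF t] \<Omega> by auto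
    qed
    ultimately have "(LINT x|lebesgue. indicator (cbox a b) x *\<^sub>R g x * indicator (box a b) x) = 0"
      by (simp add: LIMSEQ_const_iff)
    moreover have "indicator (cbox a b) x *\<^sub>R g x * indicator (box a b) x = indicator (box a b) x * g x" for x
      using box_subset_cbox[of a b] by (auto simp: indicator_def)
    ultimately show ?thesis by (simp only:)
  qed
  have AE_cbox: "AE x in lebesgue. x \<in> cbox a b \<longrightarrow> g x = 0" if ab: "cbox a b \<subseteq> \<Omega>" for a b
  proof -
    \<comment> \<open>\<open>g\<close> is only locally integrable. Cut off to one box it becomes
      integrable on the whole space, and its integrals over other boxes are box integrals of
      \<open>g\<close> again.\<close>
    define h where "h = (\<lambda>x. indicator (box a b) x *\<^sub>R (indicator (cbox a b) x *\<^sub>R g x))"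
    have heq: "h x = indicator (box a b) x * g x" for x
      using box_subset_cbox[of a b] by (auto simp: indicator_def h_def)
    have "AE x in lebesgue. h x = 0"
    proof (rule integral_zero_on_boxes_imp_zero)
      show "integrable lebesgue h"
        unfolding h_def by (intro integrable_mult_indicator gi[OF ab]) auto
      show "(LINT x|lebesgue. h x) = 0" unfolding heq by (rule box0[OF ab])
      fix c d
      obtain p q where pq: "box a b \<inter> box c d = box p q" unfolding box_Int_box by blast
      have "(LINT x:box c d|lebesgue. h x) = (LINT x|lebesgue. indicator (box p q) x * g x)"
        unfolding set_lebesgue_integral_def heq pq[symmetric]
        by (intro Bochner_Integration.integral_cong) (auto simp: indicator_def)
      also have "\<dots> = 0"
      \<comment> \<open>If the open box is empty, the corners may still span a nonempty degenerate
        closed box, so the inclusion of closed boxes is available only in the other case.\<close>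
      proof (cases "box p q = {}")
        case False
        then have "cbox p q \<subseteq> cbox a b" using pq by (intro box_subset_imp_cbox_subset) auto
        then show ?thesis using ab by (intro box0) auto
      qed simp
      finally show "(LINT x:box c d|lebesgue. h x) = 0" .
    qed
    moreover have "AE x in lebesgue. x \<notin> cbox a b - box a b"
      by (intro AE_completion AE_not_in null_sets_cbox_Diff_box)
    ultimately show ?thesis
      by eventually_elim (auto simp: heq)
  qed
  obtain D where D: "countable D" "D \<subseteq> Pow \<Omega>" "\<And>X. X \<in> D \<Longrightarrow> \<exists>a b. X = cbox a b" "\<Union>D = \<Omega>"
    using open_countable_Union_open_cbox[OF \<Omega>] by metis
  have "AE x in lebesgue. \<forall>X\<in>D. x \<in> X \<longrightarrow> g x = 0"
    using D AE_cbox by (subst AE_ball_countable[OF D(1)]) (metis PowD subset_iff)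
  then have "AE x in lebesgue. x \<in> \<Omega> \<longrightarrow> g x = 0"
    by eventually_elim (use D(4) in auto)
  then show ?thesis using \<Omega> by (subst AE_restrict_space_iff) auto
qed

text \<open>Makes the arbitrary choice in \<open>weak_grad\<close> harmless: almost everywhere it
  agrees with any known weak gradient, in particular with a continuous classical one.\<close>

lemma weak_gradient_AE_unique:
  fixes G G' :: "real^'n \<Rightarrow> real^'n"
  assumes \<Omega>: "open \<Omega>" and G: "has_weak_gradient \<Omega> u G" and G': "has_weak_gradient \<Omega> u G'"
  shows "AE x in lebesgue_on \<Omega>. G x = G' x"
proof -
  have i: "integrable (lebesgue_on K) (\<lambda>x. G x $ i)" "integrable (lebesgue_on K) (\<lambda>x. G' x $ i)"
    if "compact K" "K \<subseteq> \<Omega>" for K i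
    using G G' that unfolding has_weak_gradient_def
    by (auto intro!: integrable_bounded_linear[OF bounded_linear_vec_nth] Lp_loc_1_integrable)
  have "AE x in lebesgue_on \<Omega>. G x $ i - G' x $ i = 0" for i
  proof (rule fundamental_lemma[OF \<Omega>])
    show "integrable (lebesgue_on K) (\<lambda>x. G x $ i - G' x $ i)" if "compact K" "K \<subseteq> \<Omega>" for K
      using i[OF that] by auto
    fix \<phi> assume t: "test_function \<Omega> \<phi>"
    obtain K where K: "compact K" "K \<subseteq> \<Omega>" "\<And>x. x \<notin> K \<Longrightarrow> \<phi> x = 0"
      using test_function_support[OF t] by blast
    note c = C_1_on_D(2)[OF test_function_C_1[OF t]]
    have O: "\<Omega> \<in> sets lebesgue" using \<Omega> by auto
    have "integrable (lebesgue_on \<Omega>) (\<lambda>x. G x $ i * \<phi> x)" "integrable (lebesgue_on \<Omega>) (\<lambda>x. G' x $ i * \<phi> x)"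
      by (rule integrable_times_compact_support(1)[OF i(1)[OF K(1,2)] K(1,2) O c K(3)]
        integrable_times_compact_support(1)[OF i(2)[OF K(1,2)] K(1,2) O c K(3)]; assumption)+
    moreover have eq: "(LINT x|lebesgue_on \<Omega>. F x $ i * \<phi> x) = - (LINT x|lebesgue_on \<Omega>. u x * grad \<phi> x $ i)"
      if "has_weak_gradient \<Omega> u F" for F
      using that t unfolding has_weak_gradient_def by simp
    ultimately show "(LINT x|lebesgue_on \<Omega>. (G x $ i - G' x $ i) * \<phi> x) = 0"
      using eq[OF G] eq[OF G'] by (simp add: left_diff_distrib)
  qed
  then have "AE x in lebesgue_on \<Omega>. \<forall>i\<in>UNIV. G x $ i - G' x $ i = 0"
    by (subst AE_ball_countable) auto
  then show ?thesis by eventually_elim (auto simp: vec_eq_iff)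
qed

lemma Lp_loc_diff:
  assumes "Lp_loc 1 \<Omega> f" "Lp_loc 1 \<Omega> g"
  shows "Lp_loc 1 \<Omega> (\<lambda>x. f x - g x)"
proof -
  have "integrable (lebesgue_on K) (\<lambda>x. f x - g x)" if "compact K" "K \<subseteq> \<Omega>" for K
    using Lp_loc_1_integrable[OF _ that] assms by auto
  then show ?thesis
    unfolding Lp_loc_def Lp_on_def by (auto intro: borel_measurable_integrable)
qed

lemma has_weak_gradient_diff:
  assumes \<Omega>: "open \<Omega>" and u: "has_weak_gradient \<Omega> u G" and v: "has_weak_gradient \<Omega> v F"
  shows "has_weak_gradient \<Omega> (\<lambda>x. u x - v x) (\<lambda>x. G x - F x)"
  unfolding has_weak_gradient_def
proof (intro conjI allI impI)
  show "Lp_loc 1 \<Omega> (\<lambda>x. u x - v x)" "Lp_loc 1 \<Omega> (\<lambda>x. G x - F x)"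
    using u v by (auto simp: has_weak_gradient_def intro: Lp_loc_diff)
  fix \<phi> i assume t: "test_function \<Omega> \<phi>"
  obtain K where K: "compact K" "K \<subseteq> \<Omega>" "\<And>x. x \<notin> K \<Longrightarrow> \<phi> x = 0"
    using test_function_support[OF t] by blast
  note D = C_1_on_D[OF test_function_C_1[OF t]]
  have gz: "\<And>x. x \<notin> K \<Longrightarrow> grad \<phi> x $ i = 0" using grad_zero_outside[of K \<phi>, OF K(1,3)] by simp
  have 1: "integrable (lebesgue_on K) u" "integrable (lebesgue_on K) v"
      "integrable (lebesgue_on K) (\<lambda>x. G x $ i)" "integrable (lebesgue_on K) (\<lambda>x. F x $ i)"
    using u v K(1,2) unfolding has_weak_gradient_def
    by (auto intro!: integrable_bounded_linear[OF bounded_linear_vec_nth] Lp_loc_1_integrable)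
  have O: "\<Omega> \<in> sets lebesgue" using \<Omega> by auto
  have 2: "integrable (lebesgue_on \<Omega>) (\<lambda>x. u x * grad \<phi> x $ i)" "integrable (lebesgue_on \<Omega>) (\<lambda>x. v x * grad \<phi> x $ i)"
     "integrable (lebesgue_on \<Omega>) (\<lambda>x. G x $ i * \<phi> x)" "integrable (lebesgue_on \<Omega>) (\<lambda>x. F x $ i * \<phi> x)"
    by (auto intro: integrable_times_compact_support(1)[OF 1(1) K(1,2) O D(3) gz]
        integrable_times_compact_support(1)[OF 1(2) K(1,2) O D(3) gz]
        integrable_times_compact_support(1)[OF 1(3) K(1,2) O D(2) K(3)]
        integrable_times_compact_support(1)[OF 1(4) K(1,2) O D(2) K(3)])
  show "(LINT x|lebesgue_on \<Omega>. (u x - v x) * grad \<phi> x $ i) = - (LINT x|lebesgue_on \<Omega>. (G x - F x) $ i * \<phi> x)"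
    using u v t 2 unfolding has_weak_gradient_def by (simp add: left_diff_distrib)
qed

lemma Lp_on_continuous:
  fixes f :: "real^'n \<Rightarrow> 'b::euclidean_space"
  assumes f: "continuous_on UNIV f" and S: "bounded S" "S \<in> sets lebesgue" and p: "p \<ge> 0"
  shows "Lp_on p S f"
proof -
  have m: "f \<in> borel_measurable (lebesgue_on S)"
    using borel_measurable_continuous_UNIV[OF f]
    by (intro measurable_restrict_space1 measurable_completion) auto
  have "compact (closure S)" using S by simp
  then have "compact (f ` closure S)"
    using f by (meson compact_continuous_image continuous_on_subset subset_UNIV)
  then obtain M where M: "\<forall>x\<in>closure S. norm (f x) \<le> M"
    by (fastforce dest!: compact_imp_bounded simp: bounded_iff)
  have "S \<in> lmeasurable" using S by (rule bounded_set_imp_lmeasurable)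
  then interpret finite_measure "lebesgue_on S" by (rule finite_measure_lebesgue_on)
  have "integrable (lebesgue_on S) (\<lambda>x. norm (f x) powr p)"
  proof (rule integrable_const_bound)
    show "AE x in lebesgue_on S. norm (norm (f x) powr p) \<le> M powr p"
      using M closure_subset[of S] p by (intro AE_I2) (auto intro!: powr_mono2)
    show "(\<lambda>x. norm (f x) powr p) \<in> borel_measurable (lebesgue_on S)" using m by measurable
  qed
  then show ?thesis using m by (simp add: Lp_on_def)
qed

lemma Lp_loc_continuous:
  fixes f :: "real^'n \<Rightarrow> 'b::euclidean_space"
  shows "continuous_on UNIV f \<Longrightarrow> p \<ge> 0 \<Longrightarrow> Lp_loc p \<Omega> f"
  by (auto simp: Lp_loc_def compact_imp_bounded compact_sets_lebesgue intro!: Lp_on_continuous)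

lemma has_weak_gradient_C_1:
  fixes f :: "real^'n \<Rightarrow> real"
  assumes \<Omega>: "open \<Omega>" and f: "C_k_on 1 UNIV f"
  shows "has_weak_gradient \<Omega> f (grad f)"
  unfolding has_weak_gradient_def
proof (intro conjI allI impI)
  note D = C_1_on_D[OF f]
  show "Lp_loc 1 \<Omega> f" "Lp_loc 1 \<Omega> (grad f)" using D by (auto intro: Lp_loc_continuous)
  fix \<phi> i assume t: "test_function \<Omega> \<phi>"
  obtain K where K: "compact K" "K \<subseteq> \<Omega>" "\<And>x. x \<notin> K \<Longrightarrow> \<phi> x = 0"
    using test_function_support[OF t] by blast
  note E = C_1_on_D[OF test_function_C_1[OF t]]
  have O: "\<Omega> \<in> sets lebesgue" using \<Omega> by auto
  have "(LINT x|lebesgue_on \<Omega>. f x * grad \<phi> x $ i) = (LINT x|lborel. f x * grad \<phi> x $ i)"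
  proof (intro integral_lebesgue_on_support O borel_measurable_continuous_UNIV continuous_intros D E)
    show "f x * grad \<phi> x $ i = 0" if "x \<notin> \<Omega>" for x
    proof -
      have "grad \<phi> x = 0" using that K(2) grad_zero_outside[of K \<phi>, OF K(1,3)] by blast
      then show ?thesis by simp
    qed
  qed
  also have "\<dots> = - (LINT x|lborel. grad f x $ i * \<phi> x)"
    by (rule integral_by_parts[OF f test_function_C_1[OF t] K(1,3)])
  also have "(LINT x|lborel. grad f x $ i * \<phi> x) = (LINT x|lebesgue_on \<Omega>. grad f x $ i * \<phi> x)"
    using K(2,3)
    by (intro integral_lebesgue_on_support[symmetric] O borel_measurable_continuous_UNIV continuous_intros D E) auto
  finally show "(LINT x|lebesgue_on \<Omega>. f x * grad \<phi> x $ i) = - (LINT x|lebesgue_on \<Omega>. grad f x $ i * \<phi> x)" .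
qed

text \<open>Completeness of Lebesgue measure. The choice made by \<open>weak_grad\<close> is known
  only almost everywhere, and its measurability is obtained in this way.\<close>

lemma borel_measurable_lebesgue_on_AE:
  fixes f g :: "'a::euclidean_space \<Rightarrow> 'b::euclidean_space"
  assumes "f \<in> borel_measurable (lebesgue_on S)" "AE x in lebesgue_on S. f x = g x" "S \<in> sets lebesgue"
  shows "g \<in> borel_measurable (lebesgue_on S)"
proof -
  have "(\<lambda>x. indicator S x *\<^sub>R f x) \<in> borel_measurable lebesgue"
    using assms by (subst (asm) borel_measurable_restrict_space_iff) auto
  moreover have "AE x in lebesgue. x \<in> S \<longrightarrow> f x = g x"
    using assms by (subst (asm) AE_restrict_space_iff) auto
  then have "AE x in lebesgue. indicator S x *\<^sub>R f x = indicator S x *\<^sub>R g x"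
    by eventually_elim (auto simp: indicator_def)
  ultimately have "(\<lambda>x. indicator S x *\<^sub>R g x) \<in> borel_measurable lebesgue"
    by (rule borel_measurable_AE)
  then show ?thesis using assms(3) by (subst borel_measurable_restrict_space_iff) auto
qed

lemma has_weak_gradient_weak_grad: "has_weak_gradient \<Omega> u G \<Longrightarrow> has_weak_gradient \<Omega> u (weak_grad \<Omega> u)"
  unfolding weak_grad_def by (rule someI[of "has_weak_gradient \<Omega> u"])

lemma weak_grad_AE_eq:
  "open \<Omega> \<Longrightarrow> has_weak_gradient \<Omega> u G \<Longrightarrow> AE x in lebesgue_on \<Omega>. weak_grad \<Omega> u x = G x"
  by (rule weak_gradient_AE_unique[OF _ has_weak_gradient_weak_grad])

text \<open>\<open>W1p\<close> grants integrability to some weak gradient, which need not be the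
  chosen one; uniqueness transfers it.\<close>

lemma W1p_weak_grad:
  assumes \<Omega>: "open \<Omega>" and u: "W1p p \<Omega> u"
  shows "has_weak_gradient \<Omega> u (weak_grad \<Omega> u)" "Lp_on p \<Omega> (weak_grad \<Omega> u)"
proof -
  obtain G where G: "has_weak_gradient \<Omega> u G" "Lp_on p \<Omega> G" using u by (auto simp: W1p_def)
  show "has_weak_gradient \<Omega> u (weak_grad \<Omega> u)" by (rule has_weak_gradient_weak_grad[OF G(1)])
  have eq: "AE x in lebesgue_on \<Omega>. G x = weak_grad \<Omega> u x"
    using weak_grad_AE_eq[OF \<Omega> G(1)] by eventually_elim simp
  have O: "\<Omega> \<in> sets lebesgue" using \<Omega> by auto
  have m: "G \<in> borel_measurable (lebesgue_on \<Omega>)" using G(2) by (simp add: Lp_on_def)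
  have m': "weak_grad \<Omega> u \<in> borel_measurable (lebesgue_on \<Omega>)"
    by (rule borel_measurable_lebesgue_on_AE[OF m eq O])
  have "integrable (lebesgue_on \<Omega>) (\<lambda>x. norm (weak_grad \<Omega> u x) powr p)"
  proof (rule integrable_cong_AE_imp)
    show "integrable (lebesgue_on \<Omega>) (\<lambda>x. norm (G x) powr p)" using G(2) by (simp add: Lp_on_def)
    show "(\<lambda>x. norm (weak_grad \<Omega> u x) powr p) \<in> borel_measurable (lebesgue_on \<Omega>)" using m' by measurable
    show "AE x in lebesgue_on \<Omega>. norm (G x) powr p = norm (weak_grad \<Omega> u x) powr p"
      using eq by eventually_elim simp
  qed
  then show "Lp_on p \<Omega> (weak_grad \<Omega> u)" using m' by (simp add: Lp_on_def)
qed

subsection \<open>Minimizers on the cube\<close>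

lemma open_cube_eq_box: "(open_cube :: (real^'n) set) = box (\<chi> i. - 1) (\<chi> i. 1)"
  by (auto simp: open_cube_def mem_box_cart)

lemma open_open_cube: "open (open_cube :: (real^'n) set)"
  and bounded_open_cube: "bounded (open_cube :: (real^'n) set)"
  and sets_open_cube: "open_cube \<in> sets (lebesgue :: (real^'n) measure)"
  unfolding open_cube_eq_box by (simp_all add: open_box)

lemma finite_measure_open_cube: "finite_measure (lebesgue_on (open_cube :: (real^'n) set))"
  by (intro finite_measure_lebesgue_on bounded_set_imp_lmeasurable bounded_open_cube sets_open_cube)

section \<open>Seventh powers on the cube\<close>

lemma powr_7: "(x::real) \<ge> 0 \<Longrightarrow> x powr 7 = x ^ 7"
  by (cases "x = 0") (use powr_realpow'[of x 7] in auto)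

lemma Lp_on_7_iff:
  "Lp_on 7 S f \<longleftrightarrow> f \<in> borel_measurable (lebesgue_on S) \<and> integrable (lebesgue_on S) (\<lambda>x. norm (f x) ^ 7)"
  by (simp add: Lp_on_def powr_7)

lemma Lp_on_7_diff:
  assumes "Lp_on 7 S f" "Lp_on 7 S g"
  shows "Lp_on 7 S (\<lambda>x. f x - g x)"
proof -
  have m[measurable]: "f \<in> borel_measurable (lebesgue_on S)" "g \<in> borel_measurable (lebesgue_on S)"
    using assms by (auto simp: Lp_on_7_iff)
  have "integrable (lebesgue_on S) (\<lambda>x. norm (f x - g x) ^ 7)"
  proof (rule Bochner_Integration.integrable_bound)
    show "integrable (lebesgue_on S) (\<lambda>x. 2^7 * (norm (f x) ^ 7 + norm (g x) ^ 7))"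
      using assms by (auto simp: Lp_on_7_iff)
    have "norm (a - b) ^ 7 \<le> 2^7 * (norm a ^ 7 + norm b ^ 7)" for a b :: 'b
    proof -
      have "norm (a - b) \<le> 2 * max (norm a) (norm b)"
        using norm_triangle_ineq4[of a b] by linarith
      then have "norm (a - b) ^ 7 \<le> (2 * max (norm a) (norm b)) ^ 7"
        by (intro power_mono) auto
      also have "\<dots> \<le> 2^7 * (norm a ^ 7 + norm b ^ 7)"
        unfolding power_mult_distrib by (intro mult_left_mono) (auto simp: max_def)
      finally show ?thesis .
    qed
    then show "AE x in lebesgue_on S. norm (norm (f x - g x) ^ 7) \<le> norm (2^7 * (norm (f x) ^ 7 + norm (g x) ^ 7))"
      by (intro AE_I2) (simp add: abs_of_nonneg)
  qed measurable
  then show ?thesis by (simp add: Lp_on_7_iff)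
qed

text \<open>A substitute for the Hoelder inequality on spaces of finite measure. Below
  \<open>\<delta>\<close> the constant dominates, above it the seventh power, weighted so that an
  integral of size \<open>\<delta> ^ 7\<close> contributes only \<open>\<delta> ^ k\<close>.\<close>

lemma power_le_interpolation:
  fixes t \<delta> :: real
  assumes "t \<ge> 0" "\<delta> > 0" "k \<le> 7"
  shows "t ^ k \<le> \<delta> ^ k + \<delta> ^ k / \<delta> ^ 7 * t ^ 7"
proof (cases "t \<le> \<delta>")
  case True
  then have "t ^ k \<le> \<delta> ^ k" using assms by (intro power_mono)
  moreover have "0 \<le> \<delta> ^ k / \<delta> ^ 7 * t ^ 7" using assms by simp
  ultimately show ?thesis by linarith
next
  case False
  then have "(t / \<delta>) ^ k \<le> (t / \<delta>) ^ 7" using assms by (intro power_increasing) auto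
  then have "t ^ k \<le> \<delta> ^ k / \<delta> ^ 7 * t ^ 7" using assms by (simp add: power_divide field_simps)
  then show ?thesis using assms by (smt (verit) zero_less_power)
qed

lemma (in finite_measure) integral_power_interpolation:
  fixes f :: "'a \<Rightarrow> real"
  assumes f: "f \<in> borel_measurable M" "\<And>x. f x \<ge> 0" "integrable M (\<lambda>x. f x ^ 7)" and k: "k \<le> 7"
  shows "integrable M (\<lambda>x. f x ^ k)"
    "\<delta> > 0 \<Longrightarrow> (LINT x|M. f x ^ 7) \<le> \<delta> ^ 7 \<Longrightarrow> (LINT x|M. f x ^ k) \<le> \<delta> ^ k * (measure M (space M) + 1)"
proof -
  have i: "integrable M (\<lambda>x. \<delta> ^ k + \<delta> ^ k / \<delta> ^ 7 * f x ^ 7)" for \<delta> using f by auto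
  show 1: "integrable M (\<lambda>x. f x ^ k)"
    by (rule Bochner_Integration.integrable_bound[OF i[of 1]])
       (use f k power_le_interpolation[of "f _" 1 k] in \<open>auto simp: abs_of_nonneg\<close>)
  assume \<delta>: "\<delta> > 0" "(LINT x|M. f x ^ 7) \<le> \<delta> ^ 7"
  have "(LINT x|M. f x ^ k) \<le> (LINT x|M. \<delta> ^ k + \<delta> ^ k / \<delta> ^ 7 * f x ^ 7)"
    by (rule integral_mono[OF 1 i]) (use power_le_interpolation f k \<delta> in auto)
  also have "\<dots> = \<delta> ^ k * measure M (space M) + \<delta> ^ k / \<delta> ^ 7 * (LINT x|M. f x ^ 7)"
    using f by simp
  also have "\<dots> \<le> \<delta> ^ k * measure M (space M) + \<delta> ^ k / \<delta> ^ 7 * \<delta> ^ 7"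
    using \<delta> by (intro add_left_mono mult_left_mono) auto
  finally show "(LINT x|M. f x ^ k) \<le> \<delta> ^ k * (measure M (space M) + 1)"
    using \<delta>(1) by (simp add: algebra_simps)
qed

text \<open>Integration by parts against one coordinate, which is bounded by 1 on the cube,
  expresses the square integral through \<open>\<phi>\<close> times its derivative. Young's
  inequality absorbs half of the square integral, which leaves the constant 4.\<close>

lemma poincare_open_cube:
  fixes \<phi> :: "real^'n \<Rightarrow> real"
  assumes t: "test_function open_cube \<phi>"
  shows "(LINT x|lebesgue_on open_cube. \<phi> x ^ 2) \<le> 4 * (LINT x|lebesgue_on open_cube. norm (grad \<phi> x) ^ 2)"
proof -
  obtain K where K: "compact K" "K \<subseteq> open_cube" "\<And>x. x \<notin> K \<Longrightarrow> \<phi> x = 0"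
    using test_function_support[OF t] by blast
  note c = test_function_C_1[OF t] and D = C_1_on_D[OF test_function_C_1[OF t]]
  \<comment> \<open>Any coordinate serves; \<open>undefined\<close> merely names one.\<close>
  define i :: 'n where "i = undefined"
  have gz: "\<And>x. x \<notin> K \<Longrightarrow> grad \<phi> x = 0" using grad_zero_outside[of K \<phi>, OF K(1,3)] .
  have d: "((\<lambda>x. x $ i) has_derivative (\<lambda>h. axis i 1 \<bullet> h)) (at x)" for x :: "real^'n"
    by (rule has_derivative_eq_rhs[OF bounded_linear.has_derivative[OF bounded_linear_vec_nth has_derivative_ident]])
       (auto simp: inner_axis')
  have x: "C_k_on 1 UNIV (\<lambda>x::real^'n. x $ i)" "grad (\<lambda>x::real^'n. x $ i) = (\<lambda>x. axis i 1)"
    using C_1_on_I[OF d] by auto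
  have "(LINT x|lborel. x $ i * grad (\<lambda>x. \<phi> x * \<phi> x) x $ i)
      = - (LINT x|lborel. grad (\<lambda>x. x $ i) x $ i * (\<phi> x * \<phi> x))"
    using K by (intro integral_by_parts[OF x(1) C_k_on_mult[OF c c] K(1)]) auto
  then have "(LINT x|lborel. \<phi> x ^ 2) = - (LINT x|lborel. x $ i * grad (\<lambda>x. \<phi> x * \<phi> x) x $ i)"
    by (simp add: x(2) power2_eq_square)
  also have "\<dots> = (LINT x|lborel. - (x $ i * (2 * \<phi> x * grad \<phi> x $ i)))"
    by (simp add: grad_mult[OF D(1) D(1)] algebra_simps)
  also have "\<dots> \<le> (LINT x|lborel. \<phi> x ^ 2 / 2 + 2 * norm (grad \<phi> x) ^ 2)"
  proof (rule integral_mono)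
    show "integrable lborel (\<lambda>x. - (x $ i * (2 * \<phi> x * grad \<phi> x $ i)))"
      using K(3) by (intro integrable_continuous_support[OF _ K(1)] continuous_intros D) auto
    show "integrable lborel (\<lambda>x. \<phi> x ^ 2 / 2 + 2 * norm (grad \<phi> x) ^ 2)"
      using K(3) gz by (intro integrable_continuous_support[OF _ K(1)] continuous_intros D) auto
    fix x
    show "- (x $ i * (2 * \<phi> x * grad \<phi> x $ i)) \<le> \<phi> x ^ 2 / 2 + 2 * norm (grad \<phi> x) ^ 2"
    proof (cases "x \<in> K")
      case True
      then have "x \<in> open_cube" using K(2) by blast
      then have "\<bar>x $ i\<bar> \<le> 1" by (auto simp: open_cube_def abs_le_iff less_imp_le dest: spec[of _ i])
      moreover have "\<bar>grad \<phi> x $ i\<bar> \<le> norm (grad \<phi> x)" by (rule component_le_norm_cart)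
      ultimately have "\<bar>x $ i\<bar> * (2 * \<bar>\<phi> x\<bar> * \<bar>grad \<phi> x $ i\<bar>) \<le> 1 * (2 * \<bar>\<phi> x\<bar> * norm (grad \<phi> x))"
        by (intro mult_mono) auto
      moreover have "2 * \<bar>\<phi> x\<bar> * norm (grad \<phi> x) \<le> \<phi> x ^ 2 / 2 + 2 * norm (grad \<phi> x) ^ 2"
        using zero_le_power2[of "\<bar>\<phi> x\<bar> - 2 * norm (grad \<phi> x)"] by (simp add: power2_diff power_mult_distrib)
      moreover have "\<bar>x $ i * (2 * \<phi> x * grad \<phi> x $ i)\<bar> = \<bar>x $ i\<bar> * (2 * \<bar>\<phi> x\<bar> * \<bar>grad \<phi> x $ i\<bar>)"
        by (simp only: abs_mult abs_numeral)
      ultimately show ?thesis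
        using abs_ge_minus_self[of "x $ i * (2 * \<phi> x * grad \<phi> x $ i)"] by (simp only:)
    qed (simp add: K(3))
  qed
  also have "\<dots> = (LINT x|lborel. \<phi> x ^ 2) / 2 + 2 * (LINT x|lborel. norm (grad \<phi> x) ^ 2)"
  proof -
    have "integrable lborel (\<lambda>x. \<phi> x ^ 2)" "integrable lborel (\<lambda>x. norm (grad \<phi> x) ^ 2)"
      using K(3) gz by (auto intro!: integrable_continuous_support[OF _ K(1)] continuous_intros D)
    then show ?thesis by simp
  qed
  finally have "(LINT x|lborel. \<phi> x ^ 2) \<le> 4 * (LINT x|lborel. norm (grad \<phi> x) ^ 2)" by simp
  moreover have "(LINT x|lebesgue_on open_cube. \<phi> x ^ 2) = (LINT x|lborel. \<phi> x ^ 2)"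
    using K by (intro integral_lebesgue_on_support sets_open_cube borel_measurable_continuous_UNIV continuous_intros D) auto
  moreover have "(LINT x|lebesgue_on open_cube. norm (grad \<phi> x) ^ 2) = (LINT x|lborel. norm (grad \<phi> x) ^ 2)"
    using K(2) gz by (intro integral_lebesgue_on_support sets_open_cube borel_measurable_continuous_UNIV continuous_intros D) auto
  ultimately show ?thesis by simp
qed

text \<open>\<open>P\<close> is the gap between the seventh power of the norm and its tangent at
  \<open>\<eta>\<close>. It splits into the tangent gap of the scalar function r^7 at s and a
  multiple of the Cauchy-Schwarz defect. Both are nonnegative, so \<open>P = 0\<close> forces equal
  norms and, unless \<open>\<eta>\<close> is zero, equal directions.\<close>

lemma power_7_strictly_convex:
  fixes \<xi> \<eta> :: "'a::real_inner"
  defines "P \<equiv> norm \<xi> ^ 7 - norm \<eta> ^ 7 - 7 * (norm \<eta> ^ 5 * (\<eta> \<bullet> (\<xi> - \<eta>)))"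
  shows "P \<ge> 0" "P = 0 \<Longrightarrow> \<xi> = \<eta>"
proof -
  define r s where "r = norm \<xi>" and "s = norm \<eta>"
  have rs: "r \<ge> 0" "s \<ge> 0" by (auto simp: r_def s_def)
  \<comment> \<open>The double root at \<open>r = s\<close> expresses tangency; the cofactor has
    positive coefficients only.\<close>
  have "r^7 - 7 * s^6 * r + 6 * s^7 = (r - s)^2 * (r^5 + 2*r^4* s + 3*r^3* s^2 + 4*r^2* s^3 + 5*r* s^4 + 6* s^5)"
    by algebra
  moreover have P: "P = (r^7 - 7 * s^6 * r + 6 * s^7) + 7 * s^5 * (s * r - \<eta> \<bullet> \<xi>)"
    unfolding P_def inner_diff_right power2_norm_eq_inner[symmetric] r_def[symmetric] s_def[symmetric] by algebra
  moreover have cs: "\<eta> \<bullet> \<xi> \<le> s * r" unfolding r_def s_def by (rule norm_cauchy_schwarz)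
  ultimately show "P \<ge> 0" using rs by simp
  assume "P = 0"
  have n: "0 \<le> (r - s)^2 * (r^5 + 2*r^4* s + 3*r^3* s^2 + 4*r^2* s^3 + 5*r* s^4 + 6* s^5)" "0 \<le> 7 * s^5 * (s * r - \<eta> \<bullet> \<xi>)"
    using rs cs by auto
  have z: "(r - s)^2 * (r^5 + 2*r^4* s + 3*r^3* s^2 + 4*r^2* s^3 + 5*r* s^4 + 6* s^5) = 0" "7 * s^5 * (s * r - \<eta> \<bullet> \<xi>) = 0"
    using n \<open>P = 0\<close> P \<open>r^7 - _ + _ = _\<close> by linarith+
  have "r = s"
  proof (rule ccontr)
    assume ne: "r \<noteq> s"
    have q: "0 \<le> r^5" "0 \<le> 2*r^4* s" "0 \<le> 3*r^3* s^2" "0 \<le> 4*r^2* s^3" "0 \<le> 5*r* s^4" "0 \<le> 6* s^5"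
      using rs by auto
    have "r^5 + 2*r^4* s + 3*r^3* s^2 + 4*r^2* s^3 + 5*r* s^4 + 6* s^5 = 0" using z(1) ne by simp
    then have "r^5 = 0" "6* s^5 = 0" using q by linarith+
    then show False using ne by simp
  qed
  show "\<xi> = \<eta>"
  proof (cases "s = 0")
    case True
    then show ?thesis using \<open>r = s\<close> by (simp add: r_def s_def)
  next
    case False
    then have "\<eta> \<bullet> \<xi> = norm \<eta> * norm \<xi>" using z(2) by (simp add: r_def s_def)
    then show ?thesis using \<open>r = s\<close> False by (simp add: norm_cauchy_schwarz_eq r_def s_def)
  qed
qed

text \<open>\<open>W1p_norm\<close> involves the chosen weak gradient of the difference. Replacing
  it by \<open>D x - grad \<phi> x\<close> and undoing the seventh root gives two separate integral
  bounds, in the form required for interpolation.\<close>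

lemma W1p_0_approximation:
  fixes w :: "real^'n \<Rightarrow> real"
  assumes w: "W1p_0 7 open_cube w" and D: "has_weak_gradient open_cube w D" and \<delta>: "\<delta> > 0"
  obtains \<phi> where "test_function open_cube \<phi>"
    "Lp_on 7 open_cube (\<lambda>x. w x - \<phi> x)" "Lp_on 7 open_cube (\<lambda>x. D x - grad \<phi> x)"
    "(LINT x|lebesgue_on open_cube. norm (w x - \<phi> x) ^ 7) \<le> \<delta> ^ 7"
    "(LINT x|lebesgue_on open_cube. norm (D x - grad \<phi> x) ^ 7) \<le> \<delta> ^ 7"
proof -
  let ?M = "lebesgue_on (open_cube :: (real^'n) set)"
  have w1: "W1p 7 open_cube w" using w by (simp add: W1p_0_def)
  note O = open_open_cube sets_open_cube
  obtain \<phi> where t: "test_function open_cube \<phi>"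
    and n: "W1p_norm 7 open_cube (\<lambda>x. w x - \<phi> x) < \<delta>"
    using w \<delta> by (auto simp: W1p_0_def)
  note c = test_function_C_1[OF t] and E = C_1_on_D[OF test_function_C_1[OF t]]
  have g: "has_weak_gradient open_cube (\<lambda>x. w x - \<phi> x) (\<lambda>x. D x - grad \<phi> x)"
    by (rule has_weak_gradient_diff[OF O(1) D has_weak_gradient_C_1[OF O(1) c]])
  have eqD: "AE x in ?M. weak_grad open_cube w x = D x" by (rule weak_grad_AE_eq[OF O(1) D])
  have eq: "AE x in ?M. weak_grad open_cube (\<lambda>x. w x - \<phi> x) x = D x - grad \<phi> x"
    by (rule weak_grad_AE_eq[OF O(1) g])
  have Lw: "Lp_on 7 open_cube (\<lambda>x. w x - \<phi> x)"
  proof (rule Lp_on_7_diff)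
    show "Lp_on 7 open_cube w" using w1 by (simp add: W1p_def)
    show "Lp_on 7 open_cube \<phi>" using E by (intro Lp_on_continuous O bounded_open_cube) auto
  qed
  have LD: "Lp_on 7 open_cube D"
  proof -
    have L: "Lp_on 7 open_cube (weak_grad open_cube w)" by (rule W1p_weak_grad[OF O(1) w1])
    then have m: "D \<in> borel_measurable ?M"
      using borel_measurable_lebesgue_on_AE[OF _ eqD O(2)] by (simp add: Lp_on_def)
    have "integrable ?M (\<lambda>x. norm (D x) ^ 7)"
    proof (rule integrable_cong_AE_imp)
      show "integrable ?M (\<lambda>x. norm (weak_grad open_cube w x) ^ 7)" using L by (simp add: Lp_on_7_iff)
      show "(\<lambda>x. norm (D x) ^ 7) \<in> borel_measurable ?M" using m by measurable
      show "AE x in ?M. norm (weak_grad open_cube w x) ^ 7 = norm (D x) ^ 7"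
        using eqD by eventually_elim simp
    qed
    then show ?thesis using m by (simp add: Lp_on_7_iff)
  qed
  have LE: "Lp_on 7 open_cube (\<lambda>x. D x - grad \<phi> x)"
    by (rule Lp_on_7_diff[OF LD]) (use E in \<open>auto intro: Lp_on_continuous O bounded_open_cube\<close>)
  let ?A = "LINT x|?M. norm (w x - \<phi> x) ^ 7" and ?B = "LINT x|?M. norm (D x - grad \<phi> x) ^ 7"
  have m1: "(\<lambda>x. D x - grad \<phi> x) \<in> borel_measurable ?M" using LE by (simp add: Lp_on_def)
  have m2: "weak_grad open_cube (\<lambda>x. w x - \<phi> x) \<in> borel_measurable ?M"
    by (rule borel_measurable_lebesgue_on_AE[OF m1 _ O(2)]) (use eq in \<open>eventually_elim; simp\<close>)
  have "(LINT x|?M. norm (weak_grad open_cube (\<lambda>x. w x - \<phi> x) x) powr 7) = ?B"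
    using m1 m2 by (intro integral_cong_AE) (auto intro: AE_mp[OF eq] simp: powr_7)
  then have lt: "(?A + ?B) powr (1/7) < \<delta>"
    using n by (simp add: W1p_norm_def powr_7)
  have nn: "?A \<ge> 0" "?B \<ge> 0" by (auto intro: integral_nonneg_AE)
  have "?A + ?B = ((?A + ?B) powr (1/7)) powr 7"
    using nn by (simp add: powr_powr)
  also have "\<dots> \<le> \<delta> ^ 7"
    using lt by (subst powr_7) (auto intro!: power_mono)
  finally have "?A \<le> \<delta> ^ 7" "?B \<le> \<delta> ^ 7" using nn by linarith+
  then show ?thesis by (rule that[OF t Lw LE])
qed

lemma open_cube_power_interpolation:
  fixes f :: "real^'n \<Rightarrow> 'b::euclidean_space"
  assumes "Lp_on 7 open_cube f" "k \<le> 7"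
  shows "integrable (lebesgue_on open_cube) (\<lambda>x. norm (f x) ^ k)"
    "\<delta> > 0 \<Longrightarrow> (LINT x|lebesgue_on open_cube. norm (f x) ^ 7) \<le> \<delta> ^ 7 \<Longrightarrow>
      (LINT x|lebesgue_on open_cube. norm (f x) ^ k)
        \<le> \<delta> ^ k * (measure (lebesgue_on (open_cube :: (real^'n) set)) (space (lebesgue_on open_cube)) + 1)"
  using finite_measure.integral_power_interpolation[OF finite_measure_open_cube, of "\<lambda>x. norm (f x)" k] assms
  unfolding Lp_on_7_iff by auto

lemma nonpos_if_le_multiples:
  fixes a B :: real
  assumes "\<And>\<delta>. \<delta> > 0 \<Longrightarrow> a \<le> \<delta> * B"
  shows "a \<le> 0"
proof (rule field_le_epsilon)
  fix e :: real assume "e > 0"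
  have "a \<le> e / (\<bar>B\<bar> + 1) * B" by (rule assms) (use \<open>e > 0\<close> in auto)
  also have "\<dots> = e * (B / (\<bar>B\<bar> + 1))" by simp
  also have "\<dots> \<le> e * 1" using \<open>e > 0\<close> by (intro mult_left_mono) (auto simp: divide_le_eq)
  finally show "a \<le> 0 + e" by simp
qed

text \<open>The Poincare inequality is available for test functions. As \<open>D\<close> vanishes,
  an approximating test function has a small gradient, so it is small in mean square, and
  \<open>w\<close> is close to it.\<close>

lemma W1p_0_gradient_zero_imp_zero:
  fixes w :: "real^'n \<Rightarrow> real"
  assumes w: "W1p_0 7 open_cube w" and D: "has_weak_gradient open_cube w D"
    and z: "AE x in lebesgue_on open_cube. D x = 0"
  shows "AE x in lebesgue_on open_cube. w x = 0"
proof -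
  let ?M = "lebesgue_on (open_cube :: (real^'n) set)"
  interpret finite_measure ?M by (rule finite_measure_open_cube)
  let ?m = "measure ?M (space ?M) + 1"
  have Lw: "Lp_on 7 open_cube w" using w by (simp add: W1p_0_def W1p_def)
  have iw: "integrable ?M (\<lambda>x. norm (w x) ^ 2)"
    by (rule open_cube_power_interpolation(1)[OF Lw]) simp
  have "(LINT x|?M. norm (w x) ^ 2) \<le> \<delta> * (10 * ?m)" if "\<delta> > 0" for \<delta>
  proof -
    \<comment> \<open>The bounds are quadratic in the approximation parameter, so its root is used.
      The factor 10 is 2 for the approximation error plus 2 times the Poincare constant 4.\<close>
    define d where "d = sqrt \<delta>"
    have d: "d > 0" "d^2 = \<delta>" using that by (auto simp: d_def)
    obtain \<phi> where t: "test_function open_cube \<phi>"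
      and L: "Lp_on 7 open_cube (\<lambda>x. w x - \<phi> x)" "Lp_on 7 open_cube (\<lambda>x. D x - grad \<phi> x)"
      and le: "(LINT x|?M. norm (w x - \<phi> x) ^ 7) \<le> d ^ 7" "(LINT x|?M. norm (D x - grad \<phi> x) ^ 7) \<le> d ^ 7"
      by (rule W1p_0_approximation[OF w D d(1)])
    note E = C_1_on_D[OF test_function_C_1[OF t]]
    have L\<phi>: "Lp_on 7 open_cube \<phi>" "Lp_on 7 open_cube (grad \<phi>)"
      using E by (auto intro!: Lp_on_continuous bounded_open_cube sets_open_cube)
    have 1: "integrable ?M (\<lambda>x. norm (w x - \<phi> x) ^ 2)" "(LINT x|?M. norm (w x - \<phi> x) ^ 2) \<le> d^2 * ?m"
      using open_cube_power_interpolation[OF L(1), of 2] d(1) le(1) by auto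
    have 2: "(LINT x|?M. norm (D x - grad \<phi> x) ^ 2) \<le> d^2 * ?m"
      using open_cube_power_interpolation(2)[OF L(2) _ d(1) le(2), of 2] by simp
    have 3: "integrable ?M (\<lambda>x. norm (\<phi> x) ^ 2)"
      by (rule open_cube_power_interpolation(1)[OF L\<phi>(1)]) simp
    have "(LINT x|?M. norm (grad \<phi> x) ^ 2) = (LINT x|?M. norm (D x - grad \<phi> x) ^ 2)"
      using L(2) L\<phi>(2) by (intro integral_cong_AE) (auto intro: AE_mp[OF z] simp: Lp_on_def)
    then have 4: "(LINT x|?M. norm (\<phi> x) ^ 2) \<le> 4 * (d^2 * ?m)"
      using poincare_open_cube[OF t] 2 by (simp only: real_norm_def power2_abs)
    have sq: "norm a ^ 2 \<le> 2 * norm (a - b) ^ 2 + 2 * norm b ^ 2" for a b :: real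
      using zero_le_power2[of "a - 2 * b"] by (simp add: power2_eq_square algebra_simps)
    have "(LINT x|?M. norm (w x) ^ 2) \<le> (LINT x|?M. 2 * norm (w x - \<phi> x) ^ 2 + 2 * norm (\<phi> x) ^ 2)"
      by (intro integral_mono Bochner_Integration.integrable_add integrable_mult_right iw 1(1) 3 sq)
    also have "\<dots> = 2 * (LINT x|?M. norm (w x - \<phi> x) ^ 2) + 2 * (LINT x|?M. norm (\<phi> x) ^ 2)"
      using 1(1) 3 by simp
    also have "\<dots> \<le> 10 * (d^2 * ?m)" using 1(2) 4 by linarith
    finally show ?thesis unfolding d(2) by (simp only: mult.left_commute)
  qed
  then have "(LINT x|?M. norm (w x) ^ 2) \<le> 0" by (rule nonpos_if_le_multiples)
  moreover have "(LINT x|?M. norm (w x) ^ 2) \<ge> 0" by (auto intro: integral_nonneg_AE)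
  ultimately have "(LINT x|?M. norm (w x) ^ 2) = 0" by linarith
  then have "AE x in ?M. norm (w x) ^ 2 = 0"
    using integral_nonneg_eq_0_iff_AE[OF iw] by auto
  then show ?thesis by eventually_elim simp
qed

text \<open>The convexity gap between the gradients of \<open>v\<close> and \<open>H\<close> is
  pointwise nonnegative. Its integral is the difference of energies, at most zero, minus a
  first-order term that vanishes by the weak equation. So the gap is zero almost everywhere, the
  gradients agree, and the boundary condition removes the difference.\<close>

lemma minimizer_AE_unique:
  fixes H v :: "real^'n \<Rightarrow> real"
  assumes H: "C_k_on 1 UNIV H"
    and weak: "\<And>\<phi>. test_function open_cube \<phi> \<Longrightarrow>
       (LINT x|lebesgue_on open_cube. norm (grad H x) ^ 5 * (grad H x \<bullet> grad \<phi> x)) = 0"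
    and v: "W1p 7 open_cube v" and w: "W1p_0 7 open_cube (\<lambda>x. v x - H x)"
    and le: "(LINT x|lebesgue_on open_cube. norm (weak_grad open_cube v x) ^ 7)
       \<le> (LINT x|lebesgue_on open_cube. norm (weak_grad open_cube H x) ^ 7)"
  shows "AE x in lebesgue_on open_cube. v x = H x"
proof -
  let ?M = "lebesgue_on (open_cube :: (real^'n) set)"
  interpret finite_measure ?M by (rule finite_measure_open_cube)
  let ?m = "measure ?M (space ?M) + 1"
  note O = open_open_cube sets_open_cube
  note E = C_1_on_D[OF H]
  define G where "G = weak_grad open_cube v"
  define D where "D = (\<lambda>x. G x - grad H x)"
  define F where "F = (\<lambda>x. norm (grad H x) ^ 5 *\<^sub>R grad H x)"
  have G: "has_weak_gradient open_cube v G" "Lp_on 7 open_cube G"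
    unfolding G_def by (rule W1p_weak_grad[OF O(1) v])+
  have D: "has_weak_gradient open_cube (\<lambda>x. v x - H x) D"
    unfolding D_def by (rule has_weak_gradient_diff[OF O(1) G(1) has_weak_gradient_C_1[OF O(1) H]])
  have LH: "Lp_on 7 open_cube (grad H)"
    using E by (intro Lp_on_continuous O bounded_open_cube) auto
  have LD: "Lp_on 7 open_cube D" unfolding D_def by (rule Lp_on_7_diff[OF G(2) LH])
  have cF: "continuous_on UNIV F" unfolding F_def using E by (intro continuous_intros)
  \<comment> \<open>\<open>H\<close> is C^1 on the whole space, so the flux is bounded on the cube
    and pairs continuously with gradients that are small merely in L^1.\<close>
  have "compact (F ` closure open_cube)"
    using cF bounded_open_cube by (meson compact_continuous_image compact_closure continuous_on_subset subset_UNIV)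
  then obtain B where B: "\<forall>x\<in>closure open_cube. norm (F x) \<le> B"
    by (fastforce dest!: compact_imp_bounded simp: bounded_iff)
  have BF: "norm (F x) \<le> max B 0" if "x \<in> open_cube" for x
    using B that closure_subset by fastforce
  have mF[measurable]: "F \<in> borel_measurable ?M"
    using borel_measurable_continuous_UNIV[OF cF]
    by (intro measurable_restrict_space1 measurable_completion) auto
  have iF: "integrable ?M (\<lambda>x. F x \<bullet> f x)"
    and leF: "\<bar>LINT x|?M. F x \<bullet> f x\<bar> \<le> max B 0 * (LINT x|?M. norm (f x) ^ 1)" if f: "Lp_on 7 open_cube f" for f
  proof -
    have [measurable]: "f \<in> borel_measurable ?M" using f by (simp add: Lp_on_def)
    have i: "integrable ?M (\<lambda>x. max B 0 * norm (f x) ^ 1)"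
      by (intro integrable_mult_right open_cube_power_interpolation(1)[OF f]) simp
    have b: "norm (F x \<bullet> f x) \<le> max B 0 * norm (f x) ^ 1" if "x \<in> open_cube" for x
      using Cauchy_Schwarz_ineq2[of "F x" "f x"] mult_right_mono[OF BF[OF that], of "norm (f x)"] by simp
    show 1: "integrable ?M (\<lambda>x. F x \<bullet> f x)"
      by (rule Bochner_Integration.integrable_bound[OF i])
         (use b in \<open>auto intro!: AE_I2 order_trans[OF _ abs_ge_self]\<close>)
    have "\<bar>LINT x|?M. F x \<bullet> f x\<bar> \<le> (LINT x|?M. \<bar>F x \<bullet> f x\<bar>)" by (rule integral_abs_bound)
    also have "\<dots> \<le> (LINT x|?M. max B 0 * norm (f x) ^ 1)"
      using b by (intro integral_mono integrable_abs 1 i) auto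
    finally show "\<bar>LINT x|?M. F x \<bullet> f x\<bar> \<le> max B 0 * (LINT x|?M. norm (f x) ^ 1)" by simp
  qed
  \<comment> \<open>The weak equation is given for test functions; by density it extends to the
    difference of \<open>v\<close> and \<open>H\<close>.\<close>
  have "\<bar>LINT x|?M. F x \<bullet> D x\<bar> \<le> \<delta> * (max B 0 * ?m)" if \<delta>: "\<delta> > 0" for \<delta>
  proof -
    obtain \<phi> where t: "test_function open_cube \<phi>"
      and L: "Lp_on 7 open_cube (\<lambda>x. D x - grad \<phi> x)"
      and le: "(LINT x|?M. norm (D x - grad \<phi> x) ^ 7) \<le> \<delta> ^ 7"
      by (rule W1p_0_approximation[OF w D \<delta>])
    have L\<phi>: "Lp_on 7 open_cube (grad \<phi>)"
      using C_1_on_D[OF test_function_C_1[OF t]] by (auto intro!: Lp_on_continuous bounded_open_cube sets_open_cube)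
    have "(LINT x|?M. F x \<bullet> (D x - grad \<phi> x)) = (LINT x|?M. F x \<bullet> D x) - (LINT x|?M. F x \<bullet> grad \<phi> x)"
      using iF[OF LD] iF[OF L\<phi>] by (simp add: inner_diff_right)
    moreover have "(LINT x|?M. F x \<bullet> grad \<phi> x) = 0"
      using weak[OF t] by (simp add: F_def)
    moreover have "(LINT x|?M. norm (D x - grad \<phi> x) ^ 1) \<le> \<delta> ^ 1 * ?m"
      by (rule open_cube_power_interpolation(2)[OF L _ \<delta> le]) simp
    then have "max B 0 * (LINT x|?M. norm (D x - grad \<phi> x) ^ 1) \<le> max B 0 * (\<delta> * ?m)"
      by (intro mult_left_mono) auto
    ultimately show ?thesis using leF[OF L] by (simp add: algebra_simps)
  qed
  then have "\<bar>LINT x|?M. F x \<bullet> D x\<bar> \<le> 0" by (rule nonpos_if_le_multiples)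
  then have FD: "(LINT x|?M. F x \<bullet> D x) = 0" by simp
  define P where "P = (\<lambda>x. norm (G x) ^ 7 - norm (grad H x) ^ 7 - 7 * (F x \<bullet> D x))"
  have P: "P x \<ge> 0" "P x = 0 \<Longrightarrow> D x = 0" for x
    using power_7_strictly_convex[where \<xi>="G x" and \<eta>="grad H x"] by (auto simp: P_def F_def D_def)
  have iP: "integrable ?M P"
    unfolding P_def using G(2) LH iF[OF LD]
    by (intro Bochner_Integration.integrable_diff integrable_mult_right) (auto simp: Lp_on_7_iff)
  have "(LINT x|?M. norm (weak_grad open_cube H x) ^ 7) = (LINT x|?M. norm (grad H x) ^ 7)"
  proof (rule integral_cong_AE)
    have eq: "AE x in ?M. weak_grad open_cube H x = grad H x"
      by (rule weak_grad_AE_eq[OF O(1) has_weak_gradient_C_1[OF O(1) H]])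
    then show "AE x in ?M. norm (weak_grad open_cube H x) ^ 7 = norm (grad H x) ^ 7"
      by eventually_elim simp
    have m: "grad H \<in> borel_measurable ?M" using LH by (simp add: Lp_on_def)
    then show "(\<lambda>x. norm (grad H x) ^ 7) \<in> borel_measurable ?M" by measurable
    have "weak_grad open_cube H \<in> borel_measurable ?M"
      by (rule borel_measurable_lebesgue_on_AE[OF m _ O(2)]) (use eq in \<open>eventually_elim; simp\<close>)
    then show "(\<lambda>x. norm (weak_grad open_cube H x) ^ 7) \<in> borel_measurable ?M" by measurable
  qed
  then have "(LINT x|?M. P x) \<le> 0"
    using G(2) LH iF[OF LD] le FD unfolding P_def by (simp add: Lp_on_7_iff G_def)
  moreover have "(LINT x|?M. P x) \<ge> 0" using P(1) by (auto intro: integral_nonneg_AE)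
  ultimately have "(LINT x|?M. P x) = 0" by linarith
  then have "AE x in ?M. P x = 0"
    using P(1) integral_nonneg_eq_0_iff_AE[OF iP] by auto
  then have "AE x in ?M. D x = 0" by eventually_elim (rule P(2))
  then have "AE x in ?M. v x - H x = 0" by (rule W1p_0_gradient_zero_imp_zero[OF w D])
  then show ?thesis by eventually_elim simp
qed

section \<open>Extrema found by following rays to the frontier\<close>

lemma exists_frontier_on_ray:
  fixes V :: "'a::real_normed_vector set"
  assumes "bounded V" "x \<in> V" "u \<noteq> 0"
  shows "\<exists>t\<ge>0. x + t *\<^sub>R u \<in> frontier V"
proof -
  obtain B where B: "\<And>y. y \<in> V \<Longrightarrow> norm y \<le> B" using assms(1) by (auto simp: bounded_iff)
  \<comment> \<open>At this parameter the norm exceeds the bound \<open>B\<close> on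
    \<open>V\<close> by at least 1, so the segment leaves \<open>V\<close> and, being connected,
    meets the frontier.\<close>
  define T where "T = (B + norm x + 1) / norm u"
  have "0 \<le> B" using B[OF assms(2)] norm_ge_zero order_trans by blast
  then have T: "T \<ge> 0" "norm (T *\<^sub>R u) = B + norm x + 1"
    using assms(3) by (auto simp: T_def)
  have "norm (T *\<^sub>R u) \<le> norm (x + T *\<^sub>R u) + norm x"
    using norm_triangle_ineq4[of "x + T *\<^sub>R u" x] by simp
  then have "x + T *\<^sub>R u \<notin> V" using T(2) B[of "x + T *\<^sub>R u"] by linarith
  moreover have "x + T *\<^sub>R u \<in> (\<lambda>t. x + t *\<^sub>R u) ` {0..T}"
    using T(1) by (intro imageI) auto
  moreover have "x \<in> (\<lambda>t. x + t *\<^sub>R u) ` {0..T}"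
    using T(1) by (intro image_eqI[where x=0]) auto
  moreover have "connected ((\<lambda>t. x + t *\<^sub>R u) ` {0..T})"
    by (intro connected_continuous_image continuous_intros) auto
  ultimately have "(\<lambda>t. x + t *\<^sub>R u) ` {0..T} \<inter> frontier V \<noteq> {}"
    using assms(2) by (intro connected_Int_frontier) blast+
  then show ?thesis by auto
qed

lemma SUP_closure_eq_SUP_frontier:
  fixes f :: "'a::topological_space \<Rightarrow> real"
  assumes V: "open V" "V \<noteq> {}" "compact (closure V)" and f: "continuous_on (closure V) f"
    and max: "\<And>x. x \<in> V \<Longrightarrow> \<exists>y\<in>frontier V. f x \<le> f y"
  shows "(SUP x\<in>closure V. f x) = (SUP x\<in>frontier V. f x)"
proof -
  have cl: "closure V = V \<union> frontier V"
    using closure_subset interior_open[OF V(1)] by (auto simp: frontier_def)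
  have ne: "frontier V \<noteq> {}" using V(2) max by blast
  have bd: "bdd_above (f ` closure V)"
    using compact_continuous_image[OF f V(3)] by (simp add: bounded_imp_bdd_above compact_imp_bounded)
  then have bd': "bdd_above (f ` frontier V)" by (rule bdd_above_mono) (auto simp: cl)
  show ?thesis
  proof (rule antisym)
    show "(SUP x\<in>closure V. f x) \<le> (SUP x\<in>frontier V. f x)"
    proof (rule cSUP_least)
      fix x assume "x \<in> closure V"
      then obtain y where "y \<in> frontier V" "f x \<le> f y" using max by (auto simp: cl)
      then show "f x \<le> (SUP x\<in>frontier V. f x)" using cSUP_upper[OF _ bd'] by fastforce
    qed (use V(2) in simp)
    show "(SUP x\<in>frontier V. f x) \<le> (SUP x\<in>closure V. f x)"
      by (rule cSUP_subset_mono[OF ne bd]) (auto simp: cl)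
  qed
qed

lemma INF_closure_eq_INF_frontier:
  fixes f :: "'a::topological_space \<Rightarrow> real"
  assumes V: "open V" "V \<noteq> {}" "compact (closure V)" and f: "continuous_on (closure V) f"
    and min: "\<And>x. x \<in> V \<Longrightarrow> \<exists>y\<in>frontier V. f y \<le> f x"
  shows "(INF x\<in>closure V. f x) = (INF x\<in>frontier V. f x)"
proof -
  have "(SUP x\<in>closure V. - f x) = (SUP x\<in>frontier V. - f x)"
    using min by (intro SUP_closure_eq_SUP_frontier V continuous_intros f) auto
  then show ?thesis by (simp add: Inf_real_def image_image)
qed

subsection \<open>The cylindrical extension\<close>

text \<open>The gradient of the planar solution at the projection of \<open>x\<close>, hence
  constant along the singular axis and its parallels.\<close>

definition cyl :: "'n \<Rightarrow> 'n \<Rightarrow> real^'n \<Rightarrow> real \<times> real" where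
  "cyl i j x = legendre_inv (x $ i, x $ j)"

definition quasiradial :: "'n \<Rightarrow> 'n \<Rightarrow> real^'n \<Rightarrow> real" where
  "quasiradial i j x = pot (cyl i j x)"

definition conjugate :: "'n \<Rightarrow> 'n \<Rightarrow> real^'n \<Rightarrow> real" where
  "conjugate i j x = stream (cyl i j x)"

lemma continuous_on_cyl: "continuous_on UNIV (cyl i j)"
  unfolding cyl_def
  by (rule continuous_on_compose2[OF continuous_legendre_inv]) (auto intro!: continuous_intros)

lemma has_derivative_coordinates:
  "((\<lambda>x::real^'n. (x $ i, x $ j)) has_derivative (\<lambda>h. (h $ i, h $ j))) (at x)"
  by (intro has_derivative_Pair bounded_linear.has_derivative[OF bounded_linear_vec_nth] has_derivative_ident)

lemma quasiradial_C_1: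
  fixes i j :: "'n::finite"
  shows "C_k_on 1 UNIV (quasiradial i j)"
    "grad (quasiradial i j) = (\<lambda>x. axis i (fst (cyl i j x)) + axis j (snd (cyl i j x)))"
proof -
  have d: "(quasiradial i j has_derivative
      (\<lambda>h. (axis i (fst (cyl i j x)) + axis j (snd (cyl i j x))) \<bullet> h)) (at x)" for x :: "real^'n"
    unfolding quasiradial_def cyl_def
    using has_derivative_compose[OF has_derivative_coordinates pot_legendre_inv_has_derivative]
    by (rule has_derivative_eq_rhs) (auto simp: inner_prod_def inner_axis' inner_add_left)
  have c: "continuous_on UNIV (\<lambda>x. (axis i (fst (cyl i j x)) + axis j (snd (cyl i j x)) :: real^'n) $ k)" for k
    using continuous_on_cyl[of i j]
    by (cases "k = i"; cases "k = j") (auto simp: axis_def intro!: continuous_intros)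
  show "C_k_on 1 UNIV (quasiradial i j)"
    "grad (quasiradial i j) = (\<lambda>x. axis i (fst (cyl i j x)) + axis j (snd (cyl i j x)))"
    by (rule C_1_on_I[OF d c])+
qed

lemma conjugate_C_1:
  fixes i j :: "'n::finite"
  shows "C_k_on 1 UNIV (conjugate i j)"
    "grad (conjugate i j) = (\<lambda>x. axis j (norm (cyl i j x) ^ 5 * fst (cyl i j x))
       - axis i (norm (cyl i j x) ^ 5 * snd (cyl i j x)))"
proof -
  let ?G = "\<lambda>x::real^'n. axis j (norm (cyl i j x) ^ 5 * fst (cyl i j x)) - axis i (norm (cyl i j x) ^ 5 * snd (cyl i j x)) :: real^'n"
  have d: "(conjugate i j has_derivative (\<lambda>h. ?G x \<bullet> h)) (at x)" for x :: "real^'n"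
    unfolding conjugate_def cyl_def
    using has_derivative_compose[OF has_derivative_coordinates stream_legendre_inv_has_derivative]
    by (rule has_derivative_eq_rhs) (auto simp: inner_axis' inner_diff_left algebra_simps)
  have c: "continuous_on UNIV (\<lambda>x. ?G x $ k)" for k
    using continuous_on_cyl[of i j]
    by (cases "k = i"; cases "k = j") (auto simp: axis_def intro!: continuous_intros)
  show "C_k_on 1 UNIV (conjugate i j)" "grad (conjugate i j) = ?G"
    by (rule C_1_on_I[OF d c])+
qed

lemma norm_axis_add:
  assumes "i \<noteq> j"
  shows "norm (axis i a + axis j b :: real^'n) = norm (a, b)"
  using assms
  by (simp add: norm_eq_sqrt_inner[of "axis i a + axis j b"] norm_Pair inner_add_left inner_axis_axis
      inner_add_right power2_eq_square)

lemma norm_grad_quasiradial: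
  "i \<noteq> j \<Longrightarrow> norm (grad (quasiradial i j) x) = norm (cyl i j x)"
  by (simp add: quasiradial_C_1(2) norm_axis_add)

lemma quasiradial_weakly_harmonic:
  fixes i j :: "'n::finite"
  assumes ij: "i \<noteq> j" and t: "test_function open_cube \<phi>"
  shows "(LINT x|lebesgue_on open_cube. norm (grad (quasiradial i j) x) ^ 5 * (grad (quasiradial i j) x \<bullet> grad \<phi> x)) = 0"
proof -
  obtain K where K: "compact K" "K \<subseteq> open_cube" "\<And>x. x \<notin> K \<Longrightarrow> \<phi> x = 0"
    using test_function_support[OF t] by blast
  have gz: "\<And>x. x \<notin> K \<Longrightarrow> grad \<phi> x = 0" using grad_zero_outside[of K \<phi>, OF K(1,3)] .
  note c = test_function_C_1[OF t] and E = C_1_on_D[OF test_function_C_1[OF t]]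
  note D = C_1_on_D[OF quasiradial_C_1(1)[of i j]] and N = C_1_on_D[OF conjugate_C_1(1)[of i j]]
  have ax: "(axis i a :: real^'n) $ i = a" "(axis j a :: real^'n) $ j = a"
    "(axis i a :: real^'n) $ j = 0" "(axis j a :: real^'n) $ i = 0" for a
    using ij by (simp_all add: axis_def)
  have "(LINT x|lebesgue_on open_cube. norm (grad (quasiradial i j) x) ^ 5 * (grad (quasiradial i j) x \<bullet> grad \<phi> x))
     = (LINT x|lborel. norm (grad (quasiradial i j) x) ^ 5 * (grad (quasiradial i j) x \<bullet> grad \<phi> x))"
  proof (intro integral_lebesgue_on_support sets_open_cube borel_measurable_continuous_UNIV continuous_intros D E)
    fix x :: "real^'n" assume "x \<notin> open_cube"
    then have "grad \<phi> x = 0" using K(2) gz by blast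
    then show "norm (grad (quasiradial i j) x) ^ 5 * (grad (quasiradial i j) x \<bullet> grad \<phi> x) = 0" by simp
  qed
  \<comment> \<open>The flux components are \<open>j\<close> and minus \<open>i\<close> of the
    gradient of \<open>conjugate\<close>. The weak equation thus becomes a skew expression in two
    gradients, which \<open>integral_grad_skew\<close> handles with C^1 regularity alone.\<close>
  also have "\<dots> = (LINT x|lborel. grad (conjugate i j) x $ j * grad \<phi> x $ i - grad (conjugate i j) x $ i * grad \<phi> x $ j)"
  proof (rule Bochner_Integration.integral_cong[OF refl])
    fix x
    show "norm (grad (quasiradial i j) x) ^ 5 * (grad (quasiradial i j) x \<bullet> grad \<phi> x)
      = grad (conjugate i j) x $ j * grad \<phi> x $ i - grad (conjugate i j) x $ i * grad \<phi> x $ j"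
      unfolding norm_grad_quasiradial[OF ij] unfolding quasiradial_C_1(2) conjugate_C_1(2)
      using ax by (simp add: inner_add_left inner_axis' algebra_simps)
  qed
  also have "\<dots> = (LINT x|lborel. grad (conjugate i j) x $ j * grad \<phi> x $ i) - (LINT x|lborel. grad (conjugate i j) x $ i * grad \<phi> x $ j)"
    using gz by (intro Bochner_Integration.integral_diff integrable_continuous_support[OF _ K(1)] continuous_intros N E) auto
  also have "\<dots> = 0"
    using integral_grad_skew[OF conjugate_C_1(1) c K(1,3), of i j j i] by simp
  finally show ?thesis .
qed

lemma quasiradial_p_harmonic:
  fixes i j :: "'n::finite"
  assumes ij: "i \<noteq> j"
  shows "p_harmonic 7 open_cube (quasiradial i j)"
  unfolding p_harmonic_def
proof (intro conjI allI impI)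
  let ?H = "quasiradial i j"
  note O = open_open_cube sets_open_cube
  note D = C_1_on_D[OF quasiradial_C_1(1)[of i j]]
  note g = has_weak_gradient_C_1[OF O(1) quasiradial_C_1(1)[of i j]]
  show "continuous_on open_cube ?H" using D(2) by (rule continuous_on_subset) auto
  show "W1p_loc 7 open_cube ?H"
    unfolding W1p_loc_def using g D by (auto intro!: Lp_loc_continuous)
  fix \<phi> :: "real^'n \<Rightarrow> real" assume t: "test_function open_cube \<phi>"
  let ?M = "lebesgue_on (open_cube :: (real^'n) set)"
  have eq: "AE x in ?M. weak_grad open_cube ?H x = grad ?H x" by (rule weak_grad_AE_eq[OF O(1) g])
  have c: "f \<in> borel_measurable ?M" if "continuous_on UNIV f" for f :: "real^'n \<Rightarrow> real^'n"
    using borel_measurable_continuous_UNIV[OF that]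
    by (intro measurable_restrict_space1 measurable_completion) auto
  have [measurable]: "grad ?H \<in> borel_measurable ?M" "grad \<phi> \<in> borel_measurable ?M"
    using c D(4) C_1_on_D(4)[OF test_function_C_1[OF t]] by auto
  have [measurable]: "weak_grad open_cube ?H \<in> borel_measurable ?M"
    by (rule borel_measurable_lebesgue_on_AE[OF _ _ O(2), of "grad ?H"]) (use eq in \<open>auto elim: eventually_mono\<close>)
  have "(LINT x|?M. norm (weak_grad open_cube ?H x) powr (7 - 2) * (weak_grad open_cube ?H x \<bullet> grad \<phi> x))
     = (LINT x|?M. norm (grad ?H x) ^ 5 * (grad ?H x \<bullet> grad \<phi> x))"
  proof (rule integral_cong_AE)
    show "AE x in ?M. norm (weak_grad open_cube ?H x) powr (7 - 2) * (weak_grad open_cube ?H x \<bullet> grad \<phi> x)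
       = norm (grad ?H x) ^ 5 * (grad ?H x \<bullet> grad \<phi> x)"
      using eq
    proof eventually_elim
      case (elim x)
      have "norm (grad ?H x) powr (7 - 2) = norm (grad ?H x) ^ 5"
        using powr_realpow'[of "norm (grad ?H x)" 5] by simp
      then show ?case by (simp only: elim)
    qed
  qed measurable
  then show "(LINT x|?M. norm (weak_grad open_cube ?H x) powr (7 - 2) * (weak_grad open_cube ?H x \<bullet> grad \<phi> x)) = 0"
    using quasiradial_weakly_harmonic[OF ij t] by simp
qed

lemma quasiradial_C1_hoelder:
  fixes i j :: "'n::finite"
  assumes ij: "i \<noteq> j"
  shows "C1_hoelder_loc (1/2) open_cube (quasiradial i j)"
  unfolding C1_hoelder_loc_def
proof (intro conjI allI impI)
  show "C_k_on 1 open_cube (quasiradial i j)" using quasiradial_C_1(1) by (rule C_k_on_subset) auto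
  \<comment> \<open>One constant serves on the whole space: the planar distance is at most the sum
    of two coordinate differences, each at most \<open>dist x y\<close>, whence the 2 under the
    root.\<close>
  have "norm (grad (quasiradial i j) x - grad (quasiradial i j) y) \<le> sqrt 2 * dist x y powr (1/2)" for x y :: "real^'n"
  proof -
    have "grad (quasiradial i j) x - grad (quasiradial i j) y
       = axis i (fst (cyl i j x - cyl i j y)) + axis j (snd (cyl i j x - cyl i j y))"
      unfolding quasiradial_C_1(2) by (simp add: vec_eq_iff axis_def)
    then have n: "norm (grad (quasiradial i j) x - grad (quasiradial i j) y) = norm (cyl i j x - cyl i j y)"
      by (simp only: norm_axis_add[OF ij] prod.collapse)
    have "norm (cyl i j x - cyl i j y) ^ 2 \<le> norm ((x $ i, x $ j) - (y $ i, y $ j))"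
      unfolding cyl_def by (rule legendre_inv_hoelder)
    also have "\<dots> \<le> \<bar>(x - y) $ i\<bar> + \<bar>(x - y) $ j\<bar>"
      using norm_Pair_le[of "(x - y) $ i" "(x - y) $ j"] by simp
    also have "\<dots> \<le> 2 * dist x y"
      using component_le_norm_cart[of "x - y" i] component_le_norm_cart[of "x - y" j] by (simp add: dist_norm)
    finally have "norm (cyl i j x - cyl i j y) \<le> sqrt (2 * dist x y)" by (rule real_le_rsqrt)
    then show ?thesis unfolding n by (simp add: real_sqrt_mult powr_half_sqrt)
  qed
  then show "\<exists>C. \<forall>x\<in>K. \<forall>y\<in>K. norm (grad (quasiradial i j) x - grad (quasiradial i j) y) \<le> C * dist x y powr (1/2)"
    for K by blast
qed

lemma quasiradial_W1p:
  fixes i j :: "'n::finite"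
  shows "W1p 7 open_cube (quasiradial i j)"
  unfolding W1p_def
  using has_weak_gradient_C_1[OF open_open_cube quasiradial_C_1(1)[of i j]] C_1_on_D[OF quasiradial_C_1(1)[of i j]]
  by (auto intro!: Lp_on_continuous bounded_open_cube sets_open_cube)

lemma quasiradial_along_axis:
  fixes i j :: "'n::finite"
  assumes ij: "i \<noteq> j"
  shows "((\<lambda>t. quasiradial i j (x + t *\<^sub>R axis i 1)) has_real_derivative fst (legendre_inv (x $ i + t, x $ j))) (at t)"
    "((\<lambda>t. quasiradial i j (x + t *\<^sub>R axis j 1)) has_real_derivative snd (legendre_inv (x $ i, x $ j + t))) (at t)"
  using has_real_derivative_along_axis[OF quasiradial_C_1(1)[of i j], of x i t]
    has_real_derivative_along_axis[OF quasiradial_C_1(1)[of i j], of x j t] ij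
  unfolding quasiradial_C_1(2) cyl_def by (simp_all add: axis_def)

text \<open>Convexity along axis \<open>i\<close> means that from any point the function does not
  decrease in one of the two opposite directions; concavity along axis \<open>j\<close> serves the
  minimum. The segment may leave \<open>V\<close> before the chosen frontier point, which is
  harmless because the sign of the derivative persists.\<close>

lemma quasiradial_monotone:
  fixes i j :: "'n::finite"
  assumes ij: "i \<noteq> j"
  shows "lebesgue_monotone open_cube (quasiradial i j)"
  unfolding lebesgue_monotone_def
proof (intro conjI allI impI)
  let ?H = "quasiradial i j"
  have c: "continuous_on S ?H" for S
    using C_1_on_D(2)[OF quasiradial_C_1(1)] by (rule continuous_on_subset) auto
  show "continuous_on open_cube ?H" by (rule c)
  fix V :: "(real^'n) set"
  assume "open V \<and> V \<noteq> {} \<and> compact (closure V) \<and> closure V \<subseteq> open_cube"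
  then have V: "open V" "V \<noteq> {}" "compact (closure V)" by auto
  have b: "bounded V" using compact_imp_bounded[OF V(3)] closure_subset by (rule bounded_subset)
  note d = quasiradial_along_axis[OF ij]
  show "(SUP x\<in>closure V. ?H x) = (SUP x\<in>frontier V. ?H x)"
  proof (rule SUP_closure_eq_SUP_frontier[OF V c])
    fix x assume x: "x \<in> V"
    show "\<exists>y\<in>frontier V. ?H x \<le> ?H y"
    proof (cases "fst (legendre_inv (x $ i, x $ j)) \<ge> 0")
      case True
      obtain t where t: "t \<ge> 0" "x + t *\<^sub>R axis i 1 \<in> frontier V"
        using exists_frontier_on_ray[OF b x, of "axis i 1"] by auto
      have "?H (x + 0 *\<^sub>R axis i 1) \<le> ?H (x + t *\<^sub>R axis i 1)"
      proof (rule DERIV_nonneg_imp_nondecreasing[of 0 t "\<lambda>t. ?H (x + t *\<^sub>R axis i 1)"])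
        fix s :: real assume "0 \<le> s"
        then have "0 \<le> fst (legendre_inv (x $ i + s, x $ j))"
          using True legendre_inv_mono_fst[of "x $ i" "x $ i + s" "x $ j"] by simp
        then show "\<exists>y. ((\<lambda>t. ?H (x + t *\<^sub>R axis i 1)) has_real_derivative y) (at s) \<and> 0 \<le> y"
          using d(1) by blast
      qed (rule t(1))
      then show ?thesis using t(2) by auto
    next
      case False
      obtain t where t: "t \<ge> 0" "x + t *\<^sub>R (- axis i 1) \<in> frontier V"
        using exists_frontier_on_ray[OF b x, of "- axis i 1"] by auto
      have "?H (x + (-t) *\<^sub>R axis i 1) \<ge> ?H (x + 0 *\<^sub>R axis i 1)"
      proof (rule DERIV_nonpos_imp_nonincreasing[of "-t" 0 "\<lambda>t. ?H (x + t *\<^sub>R axis i 1)"])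
        fix s :: real assume "s \<le> 0"
        then have "fst (legendre_inv (x $ i + s, x $ j)) \<le> 0"
          using False legendre_inv_mono_fst[of "x $ i + s" "x $ i" "x $ j"] by simp
        then show "\<exists>y. ((\<lambda>t. ?H (x + t *\<^sub>R axis i 1)) has_real_derivative y) (at s) \<and> y \<le> 0"
          using d(1) by blast
      qed (use t(1) in simp)
      then show ?thesis using t(2) by auto
    qed
  qed
  show "(INF x\<in>closure V. ?H x) = (INF x\<in>frontier V. ?H x)"
  proof (rule INF_closure_eq_INF_frontier[OF V c])
    fix x assume x: "x \<in> V"
    show "\<exists>y\<in>frontier V. ?H y \<le> ?H x"
    proof (cases "snd (legendre_inv (x $ i, x $ j)) \<le> 0")
      case True
      obtain t where t: "t \<ge> 0" "x + t *\<^sub>R axis j 1 \<in> frontier V"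
        using exists_frontier_on_ray[OF b x, of "axis j 1"] by auto
      have "?H (x + t *\<^sub>R axis j 1) \<le> ?H (x + 0 *\<^sub>R axis j 1)"
      proof (rule DERIV_nonpos_imp_nonincreasing[of 0 t "\<lambda>t. ?H (x + t *\<^sub>R axis j 1)"])
        fix s :: real assume "0 \<le> s"
        then have "snd (legendre_inv (x $ i, x $ j + s)) \<le> 0"
          using True legendre_inv_antimono_snd[of "x $ j" "x $ j + s" "x $ i"] by simp
        then show "\<exists>y. ((\<lambda>t. ?H (x + t *\<^sub>R axis j 1)) has_real_derivative y) (at s) \<and> y \<le> 0"
          using d(2) by blast
      qed (rule t(1))
      then show ?thesis using t(2) by auto
    next
      case False
      obtain t where t: "t \<ge> 0" "x + t *\<^sub>R (- axis j 1) \<in> frontier V"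
        using exists_frontier_on_ray[OF b x, of "- axis j 1"] by auto
      have "?H (x + (-t) *\<^sub>R axis j 1) \<le> ?H (x + 0 *\<^sub>R axis j 1)"
      proof (rule DERIV_nonneg_imp_nondecreasing[of "-t" 0 "\<lambda>t. ?H (x + t *\<^sub>R axis j 1)"])
        fix s :: real assume "s \<le> 0"
        then have "0 \<le> snd (legendre_inv (x $ i, x $ j + s))"
          using False legendre_inv_antimono_snd[of "x $ j + s" "x $ j" "x $ i"] by simp
        then show "\<exists>y. ((\<lambda>t. ?H (x + t *\<^sub>R axis j 1)) has_real_derivative y) (at s) \<and> 0 \<le> y"
          using d(2) by blast
      qed (use t(1) in simp)
      then show ?thesis using t(2) by auto
    qed
  qed
qed

section \<open>Failure of second order regularity along the axis\<close>

lemma legendre_inv_on_axis: "legendre_inv (6 * t^2, 0) = (\<bar>t\<bar>, 0)"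
proof -
  have "legendre (\<bar>t\<bar>, 0) = (6 * t^2, 0)"
    by (cases "t = 0") (auto simp: legendre_def norm_Pair power2_eq_square power3_eq_cube)
  then show ?thesis by (metis legendre_inv_legendre)
qed

lemma abs_not_differentiable_at_0: "\<not> (abs has_real_derivative 0) (at (0::real))"
proof
  assume "(abs has_real_derivative 0) (at (0::real))"
  then have "((\<lambda>h. (\<bar>0 + h\<bar> - \<bar>0\<bar>) / h) \<longlongrightarrow> (0::real)) (at 0)" by (rule DERIV_D)
  moreover have "filterlim (\<lambda>n. inverse (real (Suc n))) (at 0) sequentially"
    by (intro filterlim_atI LIMSEQ_inverse_real_of_nat) auto
  ultimately have "(\<lambda>n. (\<bar>0 + inverse (real (Suc n))\<bar> - \<bar>0\<bar>) / inverse (real (Suc n))) \<longlonglongrightarrow> 0"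
    by (rule filterlim_compose)
  then have "(\<lambda>n::nat. 1) \<longlonglongrightarrow> (0::real)" by (simp del: of_nat_Suc)
  then show False by (simp add: LIMSEQ_const_iff)
qed

text \<open>A curve with velocity zero at \<open>p\<close> would carry a differentiable gradient
  component to a function with derivative zero there. Along the quadratic curve with factor
  \<open>6 * t^2\<close>, which undoes the square root, that component is the absolute value of
  t.\<close>

lemma quasiradial_not_C_2:
  fixes i j :: "'n::finite" and p :: "real^'n"
  assumes ij: "i \<noteq> j" and p: "p $ i = 0" "p $ j = 0"
  shows "\<not> C_k_near 2 p (quasiradial i j)"
proof
  let ?H = "quasiradial i j"
  assume "C_k_near 2 p ?H"
  then obtain U where U: "p \<in> U" "C_k_on (Suc (Suc 0)) U ?H"
    unfolding C_k_near_def numeral_2_eq_2 by blast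
  then have "(\<lambda>x. grad ?H x $ i) differentiable (at p)" by simp
  then obtain f' where f': "((\<lambda>x. grad ?H x $ i) has_derivative f') (at p)" by (auto simp: differentiable_def)
  have "((\<lambda>t. p + (6 * t^2) *\<^sub>R axis i 1) has_derivative (\<lambda>h. 0)) (at 0)"
    by (auto intro!: derivative_eq_intros)
  then have "((\<lambda>t. grad ?H (p + (6 * t^2) *\<^sub>R axis i 1) $ i) has_derivative (\<lambda>h. f' 0)) (at (0::real))"
    by (rule has_derivative_compose) (use f' in simp)
  moreover have "grad ?H (p + (6 * t^2) *\<^sub>R axis i 1) $ i = \<bar>t\<bar>" for t
    using p ij by (simp add: quasiradial_C_1(2) cyl_def legendre_inv_on_axis axis_def)
  moreover have "f' 0 = 0" using has_derivative_bounded_linear[OF f'] by (rule linear_simps(3))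
  ultimately have "(abs has_derivative (\<lambda>h. 0)) (at (0::real))" by simp
  then have "(abs has_real_derivative 0) (at (0::real))"
    unfolding has_field_derivative_def lambda_zero .
  then show False using abs_not_differentiable_at_0 by blast
qed

lemma continuous_AE_eq_on_open:
  fixes f g :: "'a::euclidean_space \<Rightarrow> real"
  assumes U: "open U" and f: "continuous_on U f" "continuous_on U g"
    and eq: "AE x in lebesgue. x \<in> U \<longrightarrow> f x = g x" and x: "x \<in> U"
  shows "f x = g x"
proof (rule ccontr)
  assume ne: "f x \<noteq> g x"
  define N where "N = U \<inter> (\<lambda>x. f x - g x) -` (- {0})"
  have N: "open N"
    unfolding N_def using U f by (intro continuous_open_preimage continuous_intros) auto
  then have "N \<in> null_sets lebesgue"
    by (subst AE_iff_null_sets) (use eq in \<open>auto simp: N_def elim: eventually_mono\<close>)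
  then have "negligible N" by (simp add: negligible_iff_null_sets)
  moreover have "x \<in> N" using ne x by (auto simp: N_def)
  ultimately show False using N open_not_negligible by blast
qed

text \<open>If the origin belongs to \<open>D\<close>, it is isolated there, so nearby points on a
  third coordinate axis avoid \<open>D\<close>. This is where dimension at least 3 enters.\<close>

lemma singular_axis_not_discrete:
  fixes i j :: "'n::finite" and D :: "(real^'n) set"
  assumes "CARD('n) \<ge> 3" "discrete D"
  obtains x where "x \<in> open_cube" "x \<notin> D" "x $ i = 0" "x $ j = 0"
proof (cases "0 \<in> D")
  case False
  then show ?thesis using that[of 0] by (auto simp: open_cube_def)
next
  case True
  have "card {i, j} \<le> 2" by (simp add: card_insert_if)
  then have "{i, j} \<noteq> UNIV" using assms(1) by auto
  then obtain k where k: "k \<noteq> i" "k \<noteq> j" by blast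
  obtain T where T: "open T" "T \<inter> D = {0}" 
    using discreteD[OF assms(2) True] unfolding isolated_in_def by blast
  then obtain e where e: "e > 0" "ball 0 e \<subseteq> T" using open_contains_ball by blast
  define s where "s = min (e/2) (1/2)"
  have s: "s > 0" "s < e" "s < 1" using e(1) by (auto simp: s_def)
  define x :: "real^'n" where "x = axis k s"
  have "x \<in> T" using e(2) s by (auto simp: x_def norm_eq_sqrt_inner inner_axis_axis)
  moreover have "x \<noteq> 0" using s by (auto simp: x_def axis_eq_0_iff)
  ultimately have "x \<notin> D" using T(2) by blast
  moreover have "x \<in> open_cube" using s by (auto simp: x_def open_cube_def axis_def)
  ultimately show ?thesis using that[of x] k by (auto simp: x_def axis_def)
qed

text \<open>The singular axis is given by an arbitrary pair of distinct coordinates, of which the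
  first two are an instance. A representative is any function equal to \<open>v\<close> almost
  everywhere on the cube.\<close>

theorem theorem6:
  fixes i j :: "'n::finite"
  assumes "CARD('n) \<ge> 3" and "i \<noteq> j"
  shows "\<exists>H :: real^'n \<Rightarrow> real.
    lebesgue_monotone open_cube H \<and>
    p_harmonic 7 open_cube H \<and>
    C1_hoelder_loc (1/2) open_cube H \<and>
    W1p 7 open_cube H \<and>
    (\<forall>v. W1p 7 open_cube v \<and>
         W1p_0 7 open_cube (\<lambda>x. v x - H x) \<and>
         (LINT x|lebesgue_on open_cube. norm (weak_grad open_cube v x) ^ 7)
           \<le> (LINT x|lebesgue_on open_cube. norm (weak_grad open_cube H x) ^ 7) \<longrightarrow>
         (AE x in lebesgue_on open_cube. v x = H x)) \<and>
    (\<forall>x\<in>open_cube. x $ i = 0 \<and> x $ j = 0 \<longrightarrow> \<not> C_k_near 2 x H) \<and>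
    (\<forall>v. W1p 7 open_cube v \<and>
         W1p_0 7 open_cube (\<lambda>x. v x - H x) \<and>
         (LINT x|lebesgue_on open_cube. norm (weak_grad open_cube v x) ^ 7)
           \<le> (LINT x|lebesgue_on open_cube. norm (weak_grad open_cube H x) ^ 7) \<longrightarrow>
         \<not> (\<exists>w D. (AE x in lebesgue_on open_cube. w x = v x) \<and>
                  D \<subseteq> open_cube \<and> discrete D \<and>
                  (\<forall>x\<in>open_cube - D. smooth_near x w)))"
proof -
  let ?H = "quasiradial i j"
  have unique: "AE x in lebesgue_on open_cube. v x = ?H x"
    if "W1p 7 open_cube v" "W1p_0 7 open_cube (\<lambda>x. v x - ?H x)"
      "(LINT x|lebesgue_on open_cube. norm (weak_grad open_cube v x) ^ 7)
        \<le> (LINT x|lebesgue_on open_cube. norm (weak_grad open_cube ?H x) ^ 7)" for v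
    using minimizer_AE_unique[OF quasiradial_C_1(1) quasiradial_weakly_harmonic[OF assms(2)] that] .
  have singular: "\<not> (\<exists>w D. (AE x in lebesgue_on open_cube. w x = v x) \<and>
      D \<subseteq> open_cube \<and> discrete D \<and> (\<forall>x\<in>open_cube - D. smooth_near x w))"
    if v: "AE x in lebesgue_on open_cube. v x = ?H x" for v
  proof
    assume "\<exists>w D. (AE x in lebesgue_on open_cube. w x = v x) \<and>
      D \<subseteq> open_cube \<and> discrete D \<and> (\<forall>x\<in>open_cube - D. smooth_near x w)"
    then obtain w D where w: "AE x in lebesgue_on open_cube. w x = v x" "discrete D"
      "\<And>x. x \<in> open_cube \<Longrightarrow> x \<notin> D \<Longrightarrow> smooth_near x w" by blast
    obtain p where p: "p \<in> open_cube" "p \<notin> D" "p $ i = 0" "p $ j = 0"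
      using singular_axis_not_discrete[OF assms(1) w(2)] by blast
    obtain U where U: "open U" "p \<in> U" "smooth_on U w"
      using w(3)[OF p(1,2)] by (auto simp: smooth_near_def)
    \<comment> \<open>Equality with \<open>?H\<close> is known only almost everywhere on the cube.
      On this smaller open set both functions are continuous, hence equal at every point, and
      \<open>?H\<close> would inherit second order regularity near the axis.\<close>
    define U' where "U' = U \<inter> open_cube"
    have U': "open U'" "p \<in> U'" using U p open_open_cube by (auto simp: U'_def)
    have w2: "C_k_on 2 U' w"
      using U(3) by (auto simp: smooth_on_def U'_def intro: C_k_on_subset)
    have "AE x in lebesgue_on open_cube. w x = ?H x" using w(1) v by eventually_elim simp
    then have "AE x in lebesgue. x \<in> open_cube \<longrightarrow> w x = ?H x"
      using sets_open_cube by (subst (asm) AE_restrict_space_iff) auto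
    then have "AE x in lebesgue. x \<in> U' \<longrightarrow> w x = ?H x"
      by eventually_elim (auto simp: U'_def)
    then have "w x = ?H x" if "x \<in> U'" for x
      using continuous_AE_eq_on_open[OF U'(1) C_k_on_continuous[OF w2] _ _ that]
        continuous_on_subset[OF C_1_on_D(2)[OF quasiradial_C_1(1)]] by blast
    then have "C_k_on 2 U' ?H" using C_k_on_cong[OF U'(1)] w2 by blast
    then show False using quasiradial_not_C_2[OF assms(2) p(3,4)] U' by (auto simp: C_k_near_def)
  qed
  show ?thesis
    using quasiradial_monotone[OF assms(2)] quasiradial_p_harmonic[OF assms(2)]
      quasiradial_C1_hoelder[OF assms(2)] quasiradial_W1p[of i j] quasiradial_not_C_2[OF assms(2)] unique singular
    by (intro exI[of _ ?H] conjI allI ballI impI; (elim conjE)?) auto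
qed

end
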